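(* There exists a system $\mathcal S=\{S_1,S_2,\dots,S_6\}$ of contraction similarities of $\mathbb{R}$ whose attractor $K$ is totally disconnected, satisfies $K\subset[0,1]$ and $\{0,1\}\subset K$, and such that: 1. $\mathcal S$ does not satisfy the open set condition; 2. the only non-empty intersection of distinct pieces $K_i=S_i(K)$, $K_j=S_j(K)$ ($i\neq j$) is $K_3\cap K_4$, and $K_3\cap K_4=\{S_3(0)\}=\{S_4(1)\}$; in particular $\mathcal S$ is post-critically finite; 3. the Hausdorff dimension $\dim_H K$ equals the similarity dimension $s$ of $\mathcal S$, while the $s$-dimensional Hausdorff measure satisfies $H^s(K)=0$.
   Context: For a finite system $\mathcal S=\{S_1,\dots,S_m\}$ of contraction similarities of $\mathbb{R}^n$, the attractor is the unique nonempty compact $K$ with $K=\bigcup_{i=1}^m S_i(K)$; its pieces are $K_i=S_i(K)$. The system satisfies the open set condition (OSC) if there is a nonempty open set $O$ with $S_i(O)\subset O$ for all $i$ and $S_i(O)\cap S_j(O)=\emptyset$ for $i\neq j$. With $I=\{1,\dots,m\}$, $I^\infty$ the set of infinite sequences over $I$, and $\pi:I^\infty\to K$ the address map $\pi(\alpha)=\bigcap_{n}S_{\alpha_1}\cdots S_{\alpha_n}(K)$, the critical set is $C=\bigcup_{i\neq j}K_i\cap K_j$, and $\mathcal S$ is post-critically finite if the set of $\alpha\in I^\infty$ for which there exist $i_1,\dots,i_n$ with $S_{i_1}\cdots S_{i_n}(\pi(\alpha))\in C$ is finite. If $S_i$ has ratio $r_i$, the similarity dimension $s$ is the unique solution of $\sum_i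 r_i^s=1$. *)

theory Defs
  imports "HOL-Analysis.Analysis"
begin

definition contr_sim :: "(real \<Rightarrow> real) \<Rightarrow> real \<Rightarrow> bool" where
  "contr_sim f r \<longleftrightarrow> 0 < r \<and> r < 1 \<and> (\<forall>x y. dist (f x) (f y) = r * dist x y)"

definition is_attractor :: "nat set \<Rightarrow> (nat \<Rightarrow> real \<Rightarrow> real) \<Rightarrow> real set \<Rightarrow> bool" where
  "is_attractor I S K \<longleftrightarrow> K \<noteq> {} \<and> compact K \<and> K = (\<Union>i\<in>I. S i ` K)"

definition open_set_condition :: "nat set \<Rightarrow> (nat \<Rightarrow> real \<Rightarrow> real) \<Rightarrow> bool" where
  "open_set_condition I S \<longleftrightarrow>
     (\<exists>V. open V \<and> V \<noteq> {} \<and> (\<forall>i\<in>I. S i ` V \<subseteq> V) \<and>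
          (\<forall>i\<in>I. \<forall>j\<in>I. i \<noteq> j \<longrightarrow> S i ` V \<inter> S j ` V = {}))"

definition word_map :: "(nat \<Rightarrow> real \<Rightarrow> real) \<Rightarrow> nat list \<Rightarrow> real \<Rightarrow> real" where
  "word_map S w = foldr (\<lambda>i f. S i \<circ> f) w id"

definition addr :: "(nat \<Rightarrow> real \<Rightarrow> real) \<Rightarrow> real set \<Rightarrow> (nat \<Rightarrow> nat) \<Rightarrow> real" where
  "addr S K \<alpha> = (THE x. x \<in> (\<Inter>n. word_map S (map \<alpha> [0..<n]) ` K))"

definition critical_set :: "nat set \<Rightarrow> (nat \<Rightarrow> real \<Rightarrow> real) \<Rightarrow> real set \<Rightarrow> real set" where
  "critical_set I S K = (\<Union>i\<in>I. \<Union>j\<in>I. if i \<noteq> j then S i ` K \<inter> S j ` K else {})"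

definition post_critically_finite :: "nat set \<Rightarrow> (nat \<Rightarrow> real \<Rightarrow> real) \<Rightarrow> real set \<Rightarrow> bool" where
  "post_critically_finite I S K \<longleftrightarrow>
     finite {\<alpha>. range \<alpha> \<subseteq> I \<and>
               (\<exists>w. w \<noteq> [] \<and> set w \<subseteq> I \<and> word_map S w (addr S K \<alpha>) \<in> critical_set I S K)}"

definition sim_dim :: "nat set \<Rightarrow> (nat \<Rightarrow> real) \<Rightarrow> real" where
  "sim_dim I r = (THE s. (\<Sum>i\<in>I. r i powr s) = 1)"

text \<open>Hausdorff measure (countable covers, with diam(empty set)^s = 0) and Hausdorff dimension.\<close>
definition hausdorff_pre :: "real \<Rightarrow> real \<Rightarrow> 'a::metric_space set \<Rightarrow> ennreal" where
  "hausdorff_pre s \<delta> A =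
     (INF U \<in> {U :: nat \<Rightarrow> 'a set. A \<subseteq> (\<Union>n. U n) \<and> (\<forall>n. bounded (U n) \<and> diameter (U n) \<le> \<delta>)}.
        (\<Sum>n. ennreal (diameter (U n) powr s)))"

definition hausdorff_measure :: "real \<Rightarrow> 'a::metric_space set \<Rightarrow> ennreal" where
  "hausdorff_measure s A = (SUP \<delta> \<in> {0<..}. hausdorff_pre s \<delta> A)"

definition hausdorff_dim :: "'a::metric_space set \<Rightarrow> real" where
  "hausdorff_dim A = Inf {s. 0 \<le> s \<and> hausdorff_measure s A = 0}"

definition totally_disconnected :: "'a::topological_space set \<Rightarrow> bool" where
  "totally_disconnected K \<longleftrightarrow> (\<forall>T \<subseteq> K. connected T \<longrightarrow> (\<exists>a. T \<subseteq> {a}))"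

end

theory Submission
  imports Defs
begin

text \<open>The maps \<open>S\<^sub>3\<close> and \<open>S\<^sub>4\<close> send the end points 0 and 1 of \<open>K\<close> to the same point \<open>c = 1/2\<close>, both
  with image to the right of \<open>c\<close>. Near \<open>c\<close> the pieces \<open>K\<^sub>3\<close> and \<open>K\<^sub>4\<close> are unions of copies scaled by
  powers of 1/64 and 1/81 respectively. As \<open>ln 81 / ln 64\<close> is irrational, some copies in \<open>K\<^sub>3\<close> and \<open>K\<^sub>4\<close>
  almost coincide. This rules out the open set condition, and it forces \<open>H\<^sup>s(K) = 0\<close> because an
  economical cover of one copy also covers the other.

  The ratio \<open>l\<close> of \<open>S\<^sub>3\<close> is a free parameter. For each pair of scales the parameters for which
  the corresponding copies meet form a null set, by transversality in \<open>l\<close> and because all ratios are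
  below 1/36. So for almost every \<open>l\<close> the pieces \<open>K\<^sub>3\<close> and \<open>K\<^sub>4\<close> meet only in \<open>c\<close>.

  For the dimension, the words of length \<open>n + 1\<close> ending in 2 give pairwise disjoint pieces, and the sum
  of the \<open>t\<close>-th powers of their ratios tends to infinity with \<open>n\<close> for every \<open>t < s\<close>.\<close>

section \<open>Covers by finitely many balls\<close>

definition ball_cover :: "('a::metric_space \<times> real) list \<Rightarrow> 'a set \<Rightarrow> bool" where
  "ball_cover L A \<longleftrightarrow> (\<forall>p\<in>set L. 0 < snd p) \<and> A \<subseteq> (\<Union>p\<in>set L. ball (fst p) (snd p))"

definition ball_cost :: "real \<Rightarrow> ('a::metric_space \<times> real) list \<Rightarrow> real" where
  "ball_cost s L = (\<Sum>p\<leftarrow>L. snd p powr s)"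

text \<open>This is Hausdorff content with radii in place of diameters and no bound on the sizes.
  For compact sets and s > 0 it vanishes exactly when the s-dimensional Hausdorff measure does. For
  bounded sets the infimum is not over the empty set, so the value is meaningful as a real
  number.\<close>

definition ball_content :: "real \<Rightarrow> 'a::metric_space set \<Rightarrow> real" where
  "ball_content s A = Inf {ball_cost s L | L. ball_cover L A}"

lemma ball_cost_nonneg: "0 \<le> ball_cost s L"
  unfolding ball_cost_def by (intro sum_list_nonneg) auto

lemma ball_cost_append: "ball_cost s (L @ M) = ball_cost s L + ball_cost s M"
  by (simp add: ball_cost_def)

lemma powr_le_ball_cost: "p \<in> set L \<Longrightarrow> snd p powr s \<le> ball_cost s L"
  unfolding ball_cost_def by (intro member_le_sum_list) auto

lemma ball_cover_append: "ball_cover L A \<Longrightarrow> ball_cover M B \<Longrightarrow> ball_cover (L @ M) (A \<union> B)"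
  by (auto simp: ball_cover_def)

lemma ball_cover_subset: "ball_cover L B \<Longrightarrow> A \<subseteq> B \<Longrightarrow> ball_cover L A"
  by (auto simp: ball_cover_def)

lemma bounded_imp_ball_cover:
  assumes "bounded A"
  obtains L where "ball_cover L A"
proof -
  obtain x e where xe: "A \<subseteq> ball x e" "0 < e"
    using bounded_subset_ballD[OF assms, of undefined] by auto
  show thesis
    by (rule that[of "[(x, e)]"]) (use xe in \<open>simp add: ball_cover_def\<close>)
qed

lemma ball_content_le: "ball_cover L A \<Longrightarrow> ball_content s A \<le> ball_cost s L"
  unfolding ball_content_def
  by (rule cInf_lower) (auto intro!: bdd_belowI[of _ 0] ball_cost_nonneg)

lemma ball_content_nonneg:
  assumes "bounded A" shows "0 \<le> ball_content s A"
proof -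
  obtain L where "ball_cover L A"
    using bounded_imp_ball_cover[OF assms] .
  then show ?thesis
    unfolding ball_content_def by (intro cInf_greatest) (auto simp: ball_cost_nonneg)
qed

lemma ball_content_approx:
  assumes "bounded A" "ball_content s A < c"
  obtains L where "ball_cover L A" "ball_cost s L < c"
proof -
  obtain L where "ball_cover L A"
    using bounded_imp_ball_cover[OF assms(1)] .
  then have "{ball_cost s L | L. ball_cover L A} \<noteq> {}"
    by auto
  from cInf_lessD[OF this assms(2)[unfolded ball_content_def]] show thesis
    using that by blast
qed

lemma ball_content_mono:
  assumes "bounded B" "A \<subseteq> B" shows "ball_content s A \<le> ball_content s B"
proof (rule ccontr)
  assume "\<not> ?thesis"
  then have "ball_content s B < ball_content s A" by simp
  then obtain L where L: "ball_cover L B" "ball_cost s L < ball_content s A"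
    using ball_content_approx[OF assms(1)] by blast
  have "ball_content s A \<le> ball_cost s L"
    by (rule ball_content_le[OF ball_cover_subset[OF L(1) assms(2)]])
  with L(2) show False by simp
qed

lemma ball_content_Un_le:
  assumes "bounded A" "bounded B"
  shows "ball_content s (A \<union> B) \<le> ball_content s A + ball_content s B"
proof (rule field_le_epsilon)
  fix e :: real assume "0 < e"
  obtain L where L: "ball_cover L A" "ball_cost s L < ball_content s A + e / 2"
    using ball_content_approx[OF assms(1), of s "ball_content s A + e / 2"] \<open>0 < e\<close> by auto
  obtain M where M: "ball_cover M B" "ball_cost s M < ball_content s B + e / 2"
    using ball_content_approx[OF assms(2), of s "ball_content s B + e / 2"] \<open>0 < e\<close> by auto
  have "ball_content s (A \<union> B) \<le> ball_cost s (L @ M)"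
    by (rule ball_content_le[OF ball_cover_append[OF L(1) M(1)]])
  then show "ball_content s (A \<union> B) \<le> ball_content s A + ball_content s B + e"
    using L(2) M(2) by (simp add: ball_cost_append)
qed

lemma ball_content_UN_le:
  fixes A :: "'b \<Rightarrow> 'a::metric_space set"
  assumes "finite J" "\<And>j. j \<in> J \<Longrightarrow> bounded (A j)"
  shows "ball_content s (\<Union>j\<in>J. A j) \<le> (\<Sum>j\<in>J. ball_content s (A j))"
  using assms
proof (induction J rule: finite_induct)
  case empty
  have "ball_content s ({} :: 'a set) \<le> ball_cost s ([] :: ('a \<times> real) list)"
    by (rule ball_content_le) (simp add: ball_cover_def)
  then show ?case by (simp add: ball_cost_def)
next
  case (insert j J)
  have "ball_content s (\<Union>j\<in>insert j J. A j) \<le> ball_content s (A j) + ball_content s (\<Union>j\<in>J. A j)"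
    using ball_content_Un_le[of "A j" "\<Union>j\<in>J. A j" s] insert by auto
  then show ?case using insert by auto
qed

section \<open>Similitudes and the scaling of content\<close>

text \<open>The ratio has no upper bound, so that the identity (the map of the empty word) and
  inverse maps are included.\<close>

definition similitude :: "('a::metric_space \<Rightarrow> 'a) \<Rightarrow> real \<Rightarrow> bool" where
  "similitude f c \<longleftrightarrow> 0 < c \<and> (\<forall>x y. dist (f x) (f y) = c * dist x y)"

lemma similitude_id: "similitude id 1"
  by (simp add: similitude_def)

lemma similitude_compose: "similitude f a \<Longrightarrow> similitude g b \<Longrightarrow> similitude (f \<circ> g) (a * b)"
  by (simp add: similitude_def)

lemma similitude_inj: "similitude f c \<Longrightarrow> inj f"
  by (rule injI) (metis dist_eq_0_iff less_irrefl mult_eq_0_iff similitude_def)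

lemma similitude_continuous_on: "similitude f c \<Longrightarrow> continuous_on A f"
  by (rule lipschitz_on_continuous_on[of c]) (auto simp: similitude_def lipschitz_on_def)

lemma similitude_bounded_image: "similitude f c \<Longrightarrow> bounded A \<Longrightarrow> bounded (f ` A)"
  unfolding bounded_def similitude_def by (metis imageE mult_left_mono less_imp_le)

lemma ball_cover_image:
  assumes "similitude f c" "ball_cover L A"
  shows "ball_cover (map (\<lambda>p. (f (fst p), c * snd p)) L) (f ` A)"
  unfolding ball_cover_def
proof (intro conjI subsetI)
  show "\<forall>p\<in>set (map (\<lambda>p. (f (fst p), c * snd p)) L). 0 < snd p"
    using assms by (auto simp: ball_cover_def similitude_def)
next
  fix y assume "y \<in> f ` A"
  then obtain x where x: "x \<in> A" "y = f x" by auto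
  then obtain p where p: "p \<in> set L" "dist (fst p) x < snd p"
    using assms(2) by (auto simp: ball_cover_def)
  then have "y \<in> ball (f (fst p)) (c * snd p)"
    using assms(1) x by (simp add: similitude_def)
  then show "y \<in> (\<Union>p\<in>set (map (\<lambda>p. (f (fst p), c * snd p)) L). ball (fst p) (snd p))"
    using p(1) by force
qed

lemma ball_cost_image:
  assumes "0 < c" "ball_cover L A"
  shows "ball_cost s (map (\<lambda>p. (f (fst p), c * snd p)) L) = c powr s * ball_cost s L"
proof -
  have "map ((\<lambda>p. snd p powr s) \<circ> (\<lambda>p. (f (fst p), c * snd p))) L
      = map (\<lambda>p. c powr s * snd p powr s) L"
    using assms by (auto simp: ball_cover_def powr_mult)
  then show ?thesis
    by (simp add: ball_cost_def sum_list_const_mult del: map_eq_conv)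
qed

lemma ball_content_image_le:
  assumes "similitude f c" "bounded A"
  shows "ball_content s (f ` A) \<le> c powr s * ball_content s A"
proof (rule field_le_epsilon)
  fix e :: real assume "0 < e"
  have c: "0 < c" using assms(1) by (simp add: similitude_def)
  then have "ball_content s A < ball_content s A + e / c powr s"
    using \<open>0 < e\<close> by simp
  then obtain L where L: "ball_cover L A" "ball_cost s L < ball_content s A + e / c powr s"
    using ball_content_approx[OF assms(2)] by blast
  have "ball_content s (f ` A) \<le> c powr s * ball_cost s L"
    using ball_content_le[OF ball_cover_image[OF assms(1) L(1)]] ball_cost_image[OF c L(1)] by metis
  also have "\<dots> \<le> c powr s * (ball_content s A + e / c powr s)"
    using L(2) by (intro mult_left_mono) auto
  also have "\<dots> = c powr s * ball_content s A + e"
    using c by (simp add: field_simps)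
  finally show "ball_content s (f ` A) \<le> c powr s * ball_content s A + e" .
qed

section \<open>Content and Hausdorff measure\<close>

text \<open>A cover of small total cost consists of small balls, so the bound \<delta> on the
  diameters comes for free.\<close>

lemma hausdorff_measure_eq_0_if_content:
  assumes "0 < s" "bounded A" "ball_content s A = 0"
  shows "hausdorff_measure s A = 0"
proof -
  have "hausdorff_pre s \<delta> A \<le> 0" if "0 < \<delta>" for \<delta>
  proof (rule ennreal_le_epsilon)
    fix e :: real assume "0 < e"
    \<comment> \<open>The first bound pays for the factor \<open>2 powr s\<close> between radii and
      diameters, the second forces every radius to be at most \<open>\<delta> / 2\<close>.\<close>
    define m where "m = min (e / 2 powr s) ((\<delta> / 2) powr s)"
    have "0 < m" using \<open>0 < e\<close> that by (simp add: m_def)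
    then obtain L where L: "ball_cover L A" "ball_cost s L < m"
      using ball_content_approx[OF assms(2), of s m] assms(3) by auto
    \<comment> \<open>The finite list is padded with empty sets, which cost nothing because
      \<open>0 powr s = 0\<close>.\<close>
    define U where "U n = (if n < length L then ball (fst (L ! n)) (snd (L ! n)) else {})" for n
    have pos: "0 < snd p" if "p \<in> set L" for p
      using L(1) that by (auto simp: ball_cover_def)
    have small: "snd p \<le> \<delta> / 2" if "p \<in> set L" for p
    proof -
      have "snd p powr s < (\<delta> / 2) powr s"
        using powr_le_ball_cost[OF that, of s] L(2) by (simp add: m_def)
      then show ?thesis
        using powr_mono2[of s "\<delta> / 2" "snd p"] \<open>0 < \<delta>\<close> \<open>0 < s\<close> by linarith
    qed
    have diam: "diameter (ball x \<rho>) \<le> 2 * \<rho>" if "0 < \<rho>" for x :: 'a and \<rho>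
    proof -
      have "dist y z \<le> 2 * \<rho>" if "y \<in> ball x \<rho>" "z \<in> ball x \<rho>" for y z
        using that dist_triangle2[of y z x] by (auto simp: dist_commute)
      then show ?thesis
        using that unfolding diameter_def by (auto intro!: cSUP_least)
    qed
    have "A \<subseteq> (\<Union>n. U n)"
    proof
      fix x assume "x \<in> A"
      then obtain p where p: "p \<in> set L" "x \<in> ball (fst p) (snd p)"
        using L(1) by (auto simp: ball_cover_def)
      then obtain n where "n < length L" "L ! n = p"
        by (auto simp: in_set_conv_nth)
      then have "x \<in> U n" using p by (simp add: U_def)
      then show "x \<in> (\<Union>n. U n)" by blast
    qed
    moreover have "bounded (U n) \<and> diameter (U n) \<le> \<delta>" for n
      using diam[OF pos, of "L ! n" "fst (L ! n)"] small[of "L ! n"] \<open>0 < \<delta>\<close>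
      by (auto simp: U_def)
    ultimately have "hausdorff_pre s \<delta> A \<le> (\<Sum>n. ennreal (diameter (U n) powr s))"
      unfolding hausdorff_pre_def by (intro INF_lower) auto
    also have "\<dots> = (\<Sum>n<length L. ennreal (diameter (U n) powr s))"
      by (rule suminf_finite) (auto simp: U_def)
    also have "\<dots> \<le> (\<Sum>n<length L. ennreal ((2 * snd (L ! n)) powr s))"
      using \<open>0 < s\<close> diam[OF pos]
      by (intro sum_mono ennreal_leI powr_mono2) (auto simp: U_def diameter_ge_0)
    also have "\<dots> = ennreal (\<Sum>n<length L. (2 * snd (L ! n)) powr s)"
      by simp
    also have "(\<Sum>n<length L. (2 * snd (L ! n)) powr s) = 2 powr s * ball_cost s L"
      unfolding ball_cost_def sum_list_sum_nth sum_distrib_left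
      using pos by (intro sum.cong) (auto simp: powr_mult less_imp_le)
    also have "ennreal \<dots> \<le> ennreal e"
      using L(2) by (intro ennreal_leI) (simp add: m_def field_simps)
    finally show "hausdorff_pre s \<delta> A \<le> 0 + ennreal e" by simp
  qed
  then have "hausdorff_measure s A \<le> 0"
    unfolding hausdorff_measure_def by (intro SUP_least) auto
  then show ?thesis by simp
qed

text \<open>Sets of diameter at most 1 cost no more for the exponent \<open>t\<close> than for
  \<open>s\<close>. Each is enlarged to an open ball at the price of a summable error, and
  compactness leaves finitely many balls.\<close>

lemma content_eq_0_if_hausdorff_measure:
  assumes "0 < t" "0 \<le> s" "s \<le> t" "compact K" "hausdorff_measure s K = 0"
  shows "ball_content t K = 0"
proof -
  have "ball_content t K \<le> e" if e: "0 < e" for e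
  proof -
    have "hausdorff_pre s 1 K \<le> hausdorff_measure s K"
      unfolding hausdorff_measure_def by (rule SUP_upper) auto
    then have "hausdorff_pre s 1 K < ennreal (e / 2)"
      using assms(5) e by simp
    then obtain U where U: "K \<subseteq> (\<Union>n. U n)" "\<And>n. bounded (U n)" "\<And>n. diameter (U n) \<le> 1"
      and cost: "(\<Sum>n. ennreal (diameter (U n) powr s)) < ennreal (e / 2)"
      unfolding hausdorff_pre_def INF_less_iff by auto
    have "\<exists>p. 0 < snd p \<and> U n \<subseteq> ball (fst p) (snd p)
        \<and> snd p powr t \<le> diameter (U n) powr s + (e / 2) * (1 / 2) ^ Suc n" for n
    proof -
      define d where "d = diameter (U n)"
      have d: "0 \<le> d" "d \<le> 1" using U by (auto simp: d_def diameter_ge_0)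
      \<comment> \<open>Continuity of the power from the right, valid also at \<open>d = 0\<close>
        since \<open>t\<close> is positive, leaves room for a radius strictly above the
        diameter.\<close>
      have "((\<lambda>x. x powr t) \<longlongrightarrow> d powr t) (at_right d)"
        using assms(1) d by (intro tendsto_powr' tendsto_ident_at tendsto_const)
          (auto simp: eventually_at_filter)
      then have "\<forall>\<^sub>F x in at_right d. x powr t < d powr t + (e / 2) * (1 / 2) ^ Suc n"
        using e by (intro order_tendstoD) auto
      then have "\<exists>x>d. x powr t < d powr t + (e / 2) * (1 / 2) ^ Suc n"
        unfolding eventually_at_right_field by (metis dense)
      then obtain x where x: "d < x" "x powr t < d powr t + (e / 2) * (1 / 2) ^ Suc n"
        by auto
      \<comment> \<open>For \<open>d = 0\<close> both sides are 0, even when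
        \<open>s = 0\<close>.\<close>
      have "d powr t \<le> d powr s"
        using d assms(3) by (cases "d = 0") (auto intro: powr_mono')
      moreover obtain y where "U n \<subseteq> ball y x"
      proof (cases "U n = {}")
        case False
        then obtain y where "y \<in> U n" by auto
        then have "U n \<subseteq> ball y x"
          using diameter_bounded_bound[OF U(2)] x(1) by (fastforce simp: d_def)
        then show thesis by (rule that)
      qed (use that in auto)
      ultimately show ?thesis
        using x d by (intro exI[of _ "(y, x)"]) (auto simp: d_def)
    qed
    then obtain p where p: "\<And>n. 0 < snd (p n)" "\<And>n. U n \<subseteq> ball (fst (p n)) (snd (p n))"
      "\<And>n. snd (p n) powr t \<le> diameter (U n) powr s + (e / 2) * (1 / 2) ^ Suc n"
      by metis
    have "K \<subseteq> (\<Union>n. ball (fst (p n)) (snd (p n)))"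
      using U(1) p(2) by blast
    then obtain N where N: "finite N" "K \<subseteq> (\<Union>n\<in>N. ball (fst (p n)) (snd (p n)))"
      using compactE_image[OF assms(4), of UNIV "\<lambda>n. ball (fst (p n)) (snd (p n))"] by auto
    define L where "L = map p (sorted_list_of_set N)"
    have "ball_cover L K"
      using N p(1) by (auto simp: ball_cover_def L_def)
    moreover have "ball_cost t L \<le> e"
    proof -
      have "ball_cost t L = (\<Sum>n\<in>N. snd (p n) powr t)"
        by (simp add: ball_cost_def L_def o_def sum_list_distinct_conv_sum_set N(1))
      also have "\<dots> \<le> (\<Sum>n\<in>N. diameter (U n) powr s) + (\<Sum>n\<in>N. (e / 2) * (1 / 2) ^ Suc n)"
        unfolding sum.distrib[symmetric] by (intro sum_mono p(3))
      also have "(\<Sum>n\<in>N. diameter (U n) powr s) \<le> e / 2"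
      proof -
        have "ennreal (\<Sum>n\<in>N. diameter (U n) powr s) = (\<Sum>n\<in>N. ennreal (diameter (U n) powr s))"
          by simp
        also have "\<dots> \<le> (\<Sum>n. ennreal (diameter (U n) powr s))"
          using N(1) by (intro sum_le_suminf) auto
        also have "\<dots> \<le> ennreal (e / 2)"
          using cost by simp
        finally show ?thesis
          using e by simp
      qed
      also have "(\<Sum>n\<in>N. (e / 2) * (1 / 2) ^ Suc n) \<le> (\<Sum>n. (e / 2) * (1 / 2) ^ Suc n)"
        using N(1) e power_half_series
        by (intro sum_le_suminf summable_mult sums_summable[of _ 1]) auto
      also have "\<dots> = e / 2"
        using power_half_series sums_mult[of "\<lambda>n. (1 / 2) ^ Suc n" 1 "e / 2"]
        by (simp add: sums_iff)
      finally show ?thesis by simp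
    qed
    ultimately show ?thesis
      using ball_content_le order_trans by blast
  qed
  then have "ball_content t K \<le> 0"
    by (rule field_le_epsilon) simp
  then show ?thesis
    using ball_content_nonneg[of K t] assms(4) compact_imp_bounded by fastforce
qed

section \<open>Separated copies and a lower bound for the cost\<close>

lemma similitude_inv:
  assumes "similitude f c" "surj f" shows "similitude (inv f) (1 / c)"
  unfolding similitude_def
proof (intro conjI allI)
  show "0 < 1 / c" using assms(1) by (simp add: similitude_def)
  fix x y
  have "dist x y = c * dist (inv f x) (inv f y)"
    using assms by (metis similitude_def surj_f_inv_f)
  then show "dist (inv f x) (inv f y) = 1 / c * dist x y"
    using assms(1) by (simp add: similitude_def)
qed

text \<open>Every entry satisfies \<open>P j\<close> for at most one \<open>j\<close>, so the
  filtered lists share out the total without double counting.\<close>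

lemma sum_filter_le:
  fixes g :: "'a \<Rightarrow> real"
  assumes "finite J" "\<And>p. 0 \<le> g p"
    and "\<And>p i j. p \<in> set L \<Longrightarrow> i \<in> J \<Longrightarrow> j \<in> J \<Longrightarrow> P i p \<Longrightarrow> P j p \<Longrightarrow> i = j"
  shows "(\<Sum>j\<in>J. \<Sum>p\<leftarrow>filter (P j) L. g p) \<le> (\<Sum>p\<leftarrow>L. g p)"
  using assms(3)
proof (induction L)
  case (Cons p L)
  have "card {j \<in> J. P j p} \<le> 1"
    using Cons.prems[of p] assms(1) by (auto simp: card_le_Suc0_iff_eq)
  then have "real (card {j \<in> J. P j p}) * g p \<le> 1 * g p"
    by (intro mult_right_mono assms(2)) simp
  moreover have "(\<Sum>j\<in>J. if P j p then g p else 0) = real (card {j \<in> J. P j p}) * g p"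
    using assms(1) by (simp add: sum.If_cases Int_def)
  moreover have "(\<Sum>j\<in>J. \<Sum>p\<leftarrow>filter (P j) (p # L). g p)
      = (\<Sum>j\<in>J. if P j p then g p else 0) + (\<Sum>j\<in>J. \<Sum>p\<leftarrow>filter (P j) L. g p)"
    unfolding sum.distrib[symmetric] by (intro sum.cong) auto
  moreover have "(\<Sum>j\<in>J. \<Sum>p\<leftarrow>filter (P j) L. g p) \<le> (\<Sum>p\<leftarrow>L. g p)"
    by (rule Cons.IH) (use Cons.prems in auto)
  ultimately show ?case by simp
qed simp

text \<open>A cover that is too cheap splits into covers of the separated pieces. One of these, pulled
  back to \<open>K\<close>, is again too cheap but has fewer balls.\<close>

lemma ball_cost_ge_separated:
  fixes f :: "'j \<Rightarrow> 'a::metric_space \<Rightarrow> 'a"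
  assumes J: "finite J" "2 \<le> card J" and K: "K \<noteq> {}" and "0 < t"
    and sim: "\<And>j. j \<in> J \<Longrightarrow> similitude (f j) (c j)"
    and surj: "\<And>j. j \<in> J \<Longrightarrow> surj (f j)"
    and sub: "\<And>j. j \<in> J \<Longrightarrow> f j ` K \<subseteq> K"
    and sep: "0 < \<delta>" "\<And>i j x y. i \<in> J \<Longrightarrow> j \<in> J \<Longrightarrow> i \<noteq> j \<Longrightarrow> x \<in> f i ` K \<Longrightarrow> y \<in> f j ` K \<Longrightarrow> \<delta> \<le> dist x y"
    and ge1: "1 \<le> (\<Sum>j\<in>J. c j powr t)"
    and L: "ball_cover L K"
  shows "(\<delta> / 2) powr t \<le> ball_cost t L"
  using L
proof (induction "length L" arbitrary: L rule: less_induct)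
  case less
  show ?case
  proof (rule ccontr)
    assume "\<not> ?case"
    then have cheap: "ball_cost t L < (\<delta> / 2) powr t" by simp
    \<comment> \<open>A larger ball would use up the whole budget alone. Balls of radius below
      \<open>\<delta> / 2\<close> cannot meet two of the pieces.\<close>
    have small: "snd p < \<delta> / 2" if "p \<in> set L" for p
    proof (rule ccontr)
      assume "\<not> ?thesis"
      then have "(\<delta> / 2) powr t \<le> snd p powr t"
        using sep(1) \<open>0 < t\<close> by (intro powr_mono2) auto
      then show False
        using powr_le_ball_cost[OF that, of t] cheap by simp
    qed
    define P where "P j p \<longleftrightarrow> ball (fst p) (snd p) \<inter> f j ` K \<noteq> {}" for j and p :: "'a \<times> real"
    have uniq: "i = j" if p: "p \<in> set L" and ij: "i \<in> J" "j \<in> J" and "P i p" "P j p" for i j p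
    proof (rule ccontr)
      assume "i \<noteq> j"
      obtain x where x: "dist (fst p) x < snd p" "x \<in> f i ` K"
        using \<open>P i p\<close> by (fastforce simp: P_def)
      obtain y where y: "dist (fst p) y < snd p" "y \<in> f j ` K"
        using \<open>P j p\<close> by (fastforce simp: P_def)
      have "dist x y \<le> dist (fst p) x + dist (fst p) y"
        using dist_triangle3 by blast
      then show False
        using sep(2)[OF ij \<open>i \<noteq> j\<close> x(2) y(2)] x(1) y(1) small[OF p] by simp
    qed
    have Jne: "J \<noteq> {}" using J by auto
    \<comment> \<open>Otherwise the shares of the pieces would add up to more than the cost of
      \<open>L\<close>, because the weights \<open>c j powr t\<close> have sum at least 1.\<close>
    have "\<exists>j\<in>J. ball_cost t (filter (P j) L) \<le> c j powr t * ball_cost t L"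
    proof (rule ccontr)
      assume "\<not> ?thesis"
      then have "(\<Sum>j\<in>J. c j powr t * ball_cost t L) < (\<Sum>j\<in>J. ball_cost t (filter (P j) L))"
        using J Jne by (intro sum_strict_mono) auto
      also have "\<dots> \<le> ball_cost t L"
        unfolding ball_cost_def using J(1) uniq by (intro sum_filter_le) auto
      also have "\<dots> \<le> (\<Sum>j\<in>J. c j powr t) * ball_cost t L"
        using mult_right_mono[OF ge1 ball_cost_nonneg[of t L]] by simp
      finally show False by (simp add: sum_distrib_right)
    qed
    then obtain j where j: "j \<in> J" "ball_cost t (filter (P j) L) \<le> c j powr t * ball_cost t L"
      by auto
    have cj: "0 < c j" using sim[OF j(1)] by (simp add: similitude_def)
    have cov: "ball_cover (filter (P j) L) (f j ` K)"
      unfolding ball_cover_def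
    proof (intro conjI subsetI)
      fix x assume x: "x \<in> f j ` K"
      then obtain p where "p \<in> set L" "x \<in> ball (fst p) (snd p)"
        using less.prems sub[OF j(1)] unfolding ball_cover_def by blast
      then show "x \<in> (\<Union>p\<in>set (filter (P j) L). ball (fst p) (snd p))"
        using x by (intro UN_I[of p]) (auto simp: P_def)
    qed (use less.prems in \<open>auto simp: ball_cover_def\<close>)
    define M where "M = map (\<lambda>p. (inv (f j) (fst p), 1 / c j * snd p)) (filter (P j) L)"
    have "ball_cover M (inv (f j) ` f j ` K)"
      unfolding M_def by (rule ball_cover_image[OF similitude_inv[OF sim[OF j(1)] surj[OF j(1)]] cov])
    then have "ball_cover M K"
      using similitude_inj[OF sim[OF j(1)]] by (simp add: image_inv_f_f)
    moreover have "ball_cost t M < (\<delta> / 2) powr t"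
    proof -
      have "ball_cost t M = (1 / c j) powr t * ball_cost t (filter (P j) L)"
        unfolding M_def using cj cov by (intro ball_cost_image) auto
      also have "\<dots> \<le> (1 / c j) powr t * (c j powr t * ball_cost t L)"
        using j(2) by (intro mult_left_mono) auto
      also have "\<dots> = ball_cost t L"
        using cj by (simp add: powr_divide)
      finally show ?thesis using cheap by simp
    qed
    \<comment> \<open>A second piece meets some ball of \<open>L\<close>, and that ball misses the
      piece of \<open>j\<close>, so the filter drops it.\<close>
    moreover have "length M < length L"
    proof -
      have "\<not> J \<subseteq> {j}"
        using card_mono[of "{j}" J] J(2) by auto
      then obtain i where i: "i \<in> J" "i \<noteq> j" by blast
      obtain x where "x \<in> f i ` K" using K by auto
      then obtain p where "p \<in> set L" "P i p"
        using less.prems sub[OF i(1)] unfolding ball_cover_def P_def by blast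
      then have "p \<in> set L" "\<not> P j p" using uniq i j(1) by blast+
      then show ?thesis
        unfolding M_def by (simp add: length_filter_less)
    qed
    ultimately show False
      using less.hyps by fastforce
  qed
qed

section \<open>Iterated function systems on the unit interval\<close>

lemma word_map_Nil [simp]: "word_map S [] = id"
  by (simp add: word_map_def)

lemma word_map_Cons [simp]: "word_map S (i # w) = S i \<circ> word_map S w"
  by (simp add: word_map_def)

lemma word_map_append: "word_map S (u @ v) = word_map S u \<circ> word_map S v"
  by (induction u) (simp_all add: o_assoc)

definition word_ratio :: "(nat \<Rightarrow> real) \<Rightarrow> nat list \<Rightarrow> real" where
  "word_ratio r w = (\<Prod>i\<leftarrow>w. r i)"

lemma word_ratio_simps [simp]:
  "word_ratio r [] = 1" "word_ratio r (i # w) = r i * word_ratio r w"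
  by (simp_all add: word_ratio_def)

lemma word_ratio_append: "word_ratio r (u @ v) = word_ratio r u * word_ratio r v"
  by (simp add: word_ratio_def)

lemma word_ratio_replicate: "word_ratio r (replicate n i) = r i ^ n"
  by (induction n) simp_all

definition words :: "nat set \<Rightarrow> nat \<Rightarrow> nat list set" where
  "words I n = {w. set w \<subseteq> I \<and> length w = n}"

lemma finite_words: "finite I \<Longrightarrow> finite (words I n)"
  unfolding words_def by (rule finite_lists_length_eq)

lemma words_0 [simp]: "words I 0 = {[]}"
  by (auto simp: words_def)

lemma words_Suc: "words I (Suc n) = (\<lambda>(i, w). i # w) ` (I \<times> words I n)"
  by (auto simp: words_def length_Suc_conv image_iff)

lemma sum_words_Suc:
  "(\<Sum>w\<in>words I (Suc n). g w) = (\<Sum>i\<in>I. \<Sum>w\<in>words I n. g (i # w))"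
proof -
  have "(\<Sum>w\<in>words I (Suc n). g w) = (\<Sum>(i, w)\<in>I \<times> words I n. g (i # w))"
    unfolding words_Suc by (subst sum.reindex) (auto simp: inj_on_def case_prod_unfold)
  then show ?thesis by (simp add: sum.cartesian_product)
qed

lemma sum_words_powr:
  assumes "\<And>i. i \<in> I \<Longrightarrow> 0 < r i"
  shows "(\<Sum>w\<in>words I n. word_ratio r w powr t) = (\<Sum>i\<in>I. r i powr t) ^ n"
proof (induction n)
  case (Suc n)
  have pos: "0 \<le> word_ratio r w" if "w \<in> words I n" for w
    using that assms unfolding word_ratio_def words_def
    by (intro prod_list_nonneg) (auto simp: less_imp_le)
  have "(\<Sum>w\<in>words I (Suc n). word_ratio r w powr t)
      = (\<Sum>i\<in>I. \<Sum>w\<in>words I n. r i powr t * word_ratio r w powr t)"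
    unfolding sum_words_Suc using pos assms
    by (intro sum.cong refl) (auto simp: powr_mult less_imp_le)
  also have "\<dots> = (\<Sum>i\<in>I. r i powr t) * (\<Sum>w\<in>words I n. word_ratio r w powr t)"
    by (simp add: sum_product)
  finally show ?case using Suc by simp
qed simp

lemma card_words: "finite I \<Longrightarrow> card (words I n) = card I ^ n"
  unfolding words_def by (rule card_lists_length_eq)

section \<open>The attractor as a nested intersection\<close>

locale unit_ifs =
  fixes I :: "nat set" and S :: "nat \<Rightarrow> real \<Rightarrow> real" and r :: "nat \<Rightarrow> real"
  assumes finite_I: "finite I" and card_I: "2 \<le> card I"
    and contr: "\<And>i. i \<in> I \<Longrightarrow> contr_sim (S i) (r i)"
    and surj_S: "\<And>i. i \<in> I \<Longrightarrow> surj (S i)"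
    and S_unit: "\<And>i. i \<in> I \<Longrightarrow> S i ` {0..1} \<subseteq> {0..1}"
begin

lemma I_nonempty: "I \<noteq> {}"
  using card_I by auto

lemma r_pos: "i \<in> I \<Longrightarrow> 0 < r i" and r_less_1: "i \<in> I \<Longrightarrow> r i < 1"
  using contr by (auto simp: contr_sim_def)

lemma similitude_S: "i \<in> I \<Longrightarrow> similitude (S i) (r i)"
  using contr by (auto simp: contr_sim_def similitude_def)

lemma similitude_word: "set w \<subseteq> I \<Longrightarrow> similitude (word_map S w) (word_ratio r w)"
  by (induction w) (auto simp: similitude_id similitude_compose similitude_S)

lemma surj_word: "set w \<subseteq> I \<Longrightarrow> surj (word_map S w)"
  by (induction w) (simp_all add: comp_surj[unfolded o_def] surj_S o_def)

lemma inj_S: "i \<in> I \<Longrightarrow> inj (S i)"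
  by (rule similitude_inj[OF similitude_S])

lemma word_ratio_pos: "set w \<subseteq> I \<Longrightarrow> 0 < word_ratio r w"
  using similitude_word by (simp add: similitude_def)

definition step :: "real set \<Rightarrow> real set" where
  "step A = (\<Union>i\<in>I. S i ` A)"

definition level :: "nat \<Rightarrow> real set" where
  "level n = (step ^^ n) {0..1}"

text \<open>By \<open>S_unit\<close> the levels are decreasing non-empty compact sets, which gives
  the attractor without a fixed point theorem.\<close>

definition attractor :: "real set" where
  "attractor = (\<Inter>n. level n)"

lemma level_0: "level 0 = {0..1}" and level_Suc: "level (Suc n) = step (level n)"
  by (simp_all add: level_def)

lemma step_mono: "A \<subseteq> B \<Longrightarrow> step A \<subseteq> step B"
  by (auto simp: step_def)

lemma level_Suc_subset: "level (Suc n) \<subseteq> level n"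
proof (induction n)
  case 0
  show ?case using S_unit by (auto simp: level_Suc level_0 step_def)
next
  case (Suc n)
  then show ?case using step_mono by (simp add: level_Suc)
qed

lemma level_antimono: "m \<le> n \<Longrightarrow> level n \<subseteq> level m"
  using level_Suc_subset by (rule lift_Suc_antimono_le)

lemma compact_level: "compact (level n)"
proof (induction n)
  case (Suc n)
  then show ?case
    unfolding level_Suc step_def using finite_I similitude_S
    by (intro compact_UN compact_continuous_image) (auto intro: similitude_continuous_on)
qed (simp add: level_0)

lemma level_nonempty: "level n \<noteq> {}"
  using I_nonempty by (induction n) (auto simp: level_Suc level_0 step_def)

lemma attractor_subset: "attractor \<subseteq> {0..1}"
  unfolding attractor_def using level_0 by blast

lemma compact_attractor: "compact attractor"
  unfolding attractor_def by (intro compact_Inter) (auto simp: compact_level)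

lemma bounded_attractor: "bounded attractor"
  by (rule compact_imp_bounded[OF compact_attractor])

lemma attractor_nonempty: "attractor \<noteq> {}"
  unfolding attractor_def
  by (rule compact_nest) (auto simp: compact_level level_nonempty level_antimono)

text \<open>For the inclusion from left to right, a point of the intersection lies, for every n, in
  the image of level n under one of the maps. As there are finitely many maps, one of them occurs
  for infinitely many n, and since the levels decrease it serves all n.\<close>

lemma attractor_eq: "attractor = (\<Union>i\<in>I. S i ` attractor)"
proof
  show "attractor \<subseteq> (\<Union>i\<in>I. S i ` attractor)"
  proof
    fix x assume x: "x \<in> attractor"
    have "x \<in> level (Suc n)" for n
      using x by (simp add: attractor_def)
    then have "\<forall>n. \<exists>i\<in>I. x \<in> S i ` level n"
      unfolding level_Suc step_def by blast
    then obtain a where a: "\<And>n. a n \<in> I" "\<And>n. x \<in> S (a n) ` level n"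
      by metis
    have "finite (range a)" using finite_subset[OF _ finite_I] a(1) by blast
    then obtain i where i: "infinite {n. a n = i}"
      using inf_img_fin_domE[of a UNIV] by (auto simp: vimage_def)
    then have "{n. a n = i} \<noteq> {}" by (metis finite.emptyI)
    then have "i \<in> I" using a(1) by auto
    have "x \<in> S i ` level n" for n
    proof -
      obtain m where "n \<le> m" "a m = i"
        using i unfolding infinite_nat_iff_unbounded_le by auto
      then show ?thesis using a(2)[of m] level_antimono by blast
    qed
    then have "inv (S i) x \<in> level n" for n
      using inj_S[OF \<open>i \<in> I\<close>] by (metis imageE inv_f_f)
    then have "inv (S i) x \<in> attractor"
      by (simp add: attractor_def)
    moreover have "x = S i (inv (S i) x)"
      using surj_S[OF \<open>i \<in> I\<close>] by (simp add: surj_f_inv_f)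
    ultimately show "x \<in> (\<Union>i\<in>I. S i ` attractor)"
      using \<open>i \<in> I\<close> by blast
  qed
  show "(\<Union>i\<in>I. S i ` attractor) \<subseteq> attractor"
  proof
    fix x assume "x \<in> (\<Union>i\<in>I. S i ` attractor)"
    then have "x \<in> level (Suc n)" for n
      unfolding level_Suc step_def attractor_def by blast
    then have "x \<in> level n" for n
      using level_Suc_subset by blast
    then show "x \<in> attractor" by (simp add: attractor_def)
  qed
qed

lemma is_attractor_attractor: "is_attractor I S attractor"
  unfolding is_attractor_def using attractor_nonempty compact_attractor attractor_eq by blast

lemma fixed_point_in_attractor:
  assumes "i \<in> I" "S i x = x" "x \<in> {0..1}" shows "x \<in> attractor"
proof -
  have "x \<in> level n" for n
  proof (induction n)
    case (Suc n)
    then show ?case using assms unfolding level_Suc step_def by (metis UN_iff image_eqI)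
  qed (use assms in \<open>simp add: level_0\<close>)
  then show ?thesis by (simp add: attractor_def)
qed

lemma S_attractor: "i \<in> I \<Longrightarrow> x \<in> attractor \<Longrightarrow> S i x \<in> attractor"
  using attractor_eq by blast

lemma word_attractor: "set w \<subseteq> I \<Longrightarrow> word_map S w ` attractor \<subseteq> attractor"
  by (induction w) (auto intro!: S_attractor)

lemma word_unit: "set w \<subseteq> I \<Longrightarrow> x \<in> {0..1} \<Longrightarrow> word_map S w x \<in> {0..1}"
proof (induction w)
  case (Cons i w)
  then have "word_map S w x \<in> {0..1}" by auto
  then show ?case using S_unit[of i] Cons.prems by (simp add: image_subset_iff)
qed simp

lemma compact_word: "set w \<subseteq> I \<Longrightarrow> compact (word_map S w ` attractor)"
  using similitude_continuous_on[OF similitude_word] compact_attractor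
  by (intro compact_continuous_image) auto

lemma attractor_words: "attractor = (\<Union>w\<in>words I n. word_map S w ` attractor)"
proof (induction n)
  case (Suc n)
  have "attractor = (\<Union>i\<in>I. S i ` (\<Union>w\<in>words I n. word_map S w ` attractor))"
    using Suc attractor_eq by simp
  also have "\<dots> = (\<Union>w\<in>words I (Suc n). word_map S w ` attractor)"
    unfolding words_Suc by (fastforce simp: image_UN image_comp)
  finally show ?case .
qed simp

text \<open>\<open>addr\<close> is a definite description, so the intersection has to be shown to be
  a single point: nested compact pieces give existence, the geometric decay of their diameters gives
  uniqueness.\<close>

lemma addr_mem:
  assumes "range \<alpha> \<subseteq> I"
  shows "addr S attractor \<alpha> \<in> word_map S (map \<alpha> [0..<n]) ` attractor"
proof -
  define C where "C n = word_map S (map \<alpha> [0..<n]) ` attractor" for n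
  have sub: "set (map \<alpha> [0..<n]) \<subseteq> I" for n
    using assms by auto
  have "\<alpha> n \<in> I" for n
    using assms by auto
  then have "C (Suc n) \<subseteq> C n" for n
    unfolding C_def by (auto simp: word_map_append image_comp[symmetric] intro!: imageI S_attractor)
  then have anti: "C n \<subseteq> C m" if "m \<le> n" for m n
    using that by (rule lift_Suc_antimono_le)
  define \<rho> where "\<rho> = Max (r ` I)"
  have \<rho>: "r i \<le> \<rho>" if "i \<in> I" for i
    using that finite_I by (simp add: \<rho>_def)
  have "\<rho> \<in> r ` I"
    using finite_I I_nonempty by (simp add: \<rho>_def)
  then have \<rho>01: "0 < \<rho>" "\<rho> < 1"
    using r_pos r_less_1 by auto
  have ratio: "word_ratio r w \<le> \<rho> ^ length w" if "set w \<subseteq> I" for w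
    using that
  proof (induction w)
    case (Cons i w)
    then show ?case using \<rho>[of i] \<rho>01 word_ratio_pos[of w]
      by (auto intro!: mult_mono)
  qed simp
  have dist: "dist x y \<le> \<rho> ^ n" if "x \<in> C n" "y \<in> C n" for x y n
  proof -
    obtain x' y' where xy: "x = word_map S (map \<alpha> [0..<n]) x'" "x' \<in> attractor"
      "y = word_map S (map \<alpha> [0..<n]) y'" "y' \<in> attractor"
      using \<open>x \<in> C n\<close> \<open>y \<in> C n\<close> unfolding C_def by blast
    have "dist x y = word_ratio r (map \<alpha> [0..<n]) * dist x' y'"
      using similitude_word[OF sub] xy by (simp add: similitude_def)
    also have "\<dots> \<le> \<rho> ^ n * 1"
    proof (intro mult_mono)
      show "word_ratio r (map \<alpha> [0..<n]) \<le> \<rho> ^ n"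
        using ratio[OF sub, of n] by simp
      have "x' \<in> {0..1}" "y' \<in> {0..1}"
        using xy attractor_subset by auto
      then show "dist x' y' \<le> 1"
        by (auto simp: dist_real_def)
    qed (use \<rho>01 in auto)
    finally show ?thesis by simp
  qed
  have "(\<Inter>n. C n) \<noteq> {}"
    using compact_word[OF sub] attractor_nonempty anti
    by (intro compact_nest) (auto simp: C_def)
  then obtain x where x: "x \<in> (\<Inter>n. C n)" by auto
  have uniq: "y = x" if y: "y \<in> (\<Inter>n. C n)" for y
  proof -
    have "(\<lambda>n. \<rho> ^ n) \<longlonglongrightarrow> 0"
      using \<rho>01 by (intro LIMSEQ_power_zero) auto
    then have "dist y x \<le> 0"
      by (rule tendsto_lowerbound) (use dist x y in auto)
    then show ?thesis by simp
  qed
  have "(THE x. x \<in> (\<Inter>n. C n)) \<in> (\<Inter>n. C n)"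
    by (rule theI[of "\<lambda>x. x \<in> (\<Inter>n. C n)", OF x uniq])
  then show ?thesis
    unfolding addr_def C_def by blast
qed

section \<open>Content of pieces\<close>

text \<open>Subadditivity suffices, with no disjointness of the pieces: at each letter
  \<open>i\<close> of the word the sibling pieces cost at most their shares
  \<open>r j powr s\<close>, and these shares add up to \<open>1 - r i powr s\<close>.\<close>

lemma content_remove_word:
  assumes "(\<Sum>i\<in>I. r i powr s) = 1" "set w \<subseteq> I"
  shows "ball_content s (attractor - word_map S w ` attractor)
      \<le> (1 - word_ratio r w powr s) * ball_content s attractor"
  using assms(2)
proof (induction w)
  case Nil
  then show ?case
    using ball_content_le[of "[]" "{} :: real set" s] by (simp add: ball_cover_def ball_cost_def)
next
  case (Cons i w)
  then have i: "i \<in> I" and w: "set w \<subseteq> I" by auto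
  define D where "D = attractor - word_map S w ` attractor"
  have bD: "bounded D"
    unfolding D_def using bounded_attractor by (rule bounded_subset) auto
  have "attractor - word_map S (i # w) ` attractor \<subseteq> S i ` D \<union> (\<Union>j\<in>I - {i}. S j ` attractor)"
  proof
    fix x assume x: "x \<in> attractor - word_map S (i # w) ` attractor"
    then obtain j y where jy: "j \<in> I" "y \<in> attractor" "x = S j y"
      using attractor_eq by blast
    show "x \<in> S i ` D \<union> (\<Union>j\<in>I - {i}. S j ` attractor)"
    proof (cases "j = i")
      case True
      then have "y \<in> D" using x jy by (auto simp: D_def)
      then show ?thesis using jy True by blast
    qed (use jy in blast)
  qed
  then have "ball_content s (attractor - word_map S (i # w) ` attractor)
      \<le> ball_content s (S i ` D \<union> (\<Union>j\<in>I - {i}. S j ` attractor))"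
    using finite_I bD bounded_attractor i
    by (intro ball_content_mono) (auto intro!: bounded_UN similitude_bounded_image similitude_S)
  also have "\<dots> \<le> ball_content s (S i ` D) + ball_content s (\<Union>j\<in>I - {i}. S j ` attractor)"
    using finite_I bD bounded_attractor i
    by (intro ball_content_Un_le) (auto intro!: bounded_UN similitude_bounded_image similitude_S)
  also have "\<dots> \<le> r i powr s * ((1 - word_ratio r w powr s) * ball_content s attractor)
      + (\<Sum>j\<in>I - {i}. r j powr s * ball_content s attractor)"
  proof (intro add_mono)
    have "ball_content s (S i ` D) \<le> r i powr s * ball_content s D"
      by (intro ball_content_image_le similitude_S i bD)
    also have "\<dots> \<le> r i powr s * ((1 - word_ratio r w powr s) * ball_content s attractor)"
      using Cons.IH[OF w] by (intro mult_left_mono) (auto simp: D_def)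
    finally show "ball_content s (S i ` D) \<le> r i powr s * ((1 - word_ratio r w powr s) * ball_content s attractor)" .
    have "ball_content s (\<Union>j\<in>I - {i}. S j ` attractor) \<le> (\<Sum>j\<in>I - {i}. ball_content s (S j ` attractor))"
      using finite_I bounded_attractor
      by (intro ball_content_UN_le) (auto intro!: similitude_bounded_image similitude_S)
    also have "\<dots> \<le> (\<Sum>j\<in>I - {i}. r j powr s * ball_content s attractor)"
      by (intro sum_mono ball_content_image_le similitude_S bounded_attractor) auto
    finally show "ball_content s (\<Union>j\<in>I - {i}. S j ` attractor) \<le> (\<Sum>j\<in>I - {i}. r j powr s * ball_content s attractor)" .
  qed
  also have "(\<Sum>j\<in>I - {i}. r j powr s * ball_content s attractor) = (1 - r i powr s) * ball_content s attractor"
    using assms(1) finite_I i by (simp add: sum_distrib_right[symmetric] sum_diff1)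
  also have "r i powr s * ((1 - word_ratio r w powr s) * ball_content s attractor) + \<dots>
      = (1 - word_ratio r (i # w) powr s) * ball_content s attractor"
    using r_pos[OF i] word_ratio_pos[OF w] by (simp add: powr_mult algebra_simps)
  finally show ?case .
qed

text \<open>Subadditivity becomes a lower bound: the rest of the attractor has at most the remaining
  share of the content, so the two pieces must supply their full shares, however much they
  overlap.\<close>

lemma content_two_words_ge:
  assumes sum: "(\<Sum>i\<in>I. r i powr s) = 1" and ij: "i \<in> I" "j \<in> I" "i \<noteq> j"
    and uv: "set u \<subseteq> I" "set v \<subseteq> I"
  shows "(word_ratio r (i # u) powr s + word_ratio r (j # v) powr s) * ball_content s attractor
    \<le> ball_content s (word_map S (i # u) ` attractor \<union> word_map S (j # v) ` attractor)"
proof -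
  define C where "C = ball_content s attractor"
  define A where "A = word_map S (i # u) ` attractor \<union> word_map S (j # v) ` attractor"
  define D where "D w = attractor - word_map S w ` attractor" for w
  have bD: "bounded (D w)" for w
    unfolding D_def using bounded_attractor by (rule bounded_subset) auto
  have D_le: "ball_content s (S k ` D w) \<le> r k powr s * (1 - word_ratio r w powr s) * C"
    if "k \<in> I" "set w \<subseteq> I" for k w
  proof -
    have "ball_content s (S k ` D w) \<le> r k powr s * ball_content s (D w)"
      by (intro ball_content_image_le similitude_S that bD)
    also have "\<dots> \<le> r k powr s * ((1 - word_ratio r w powr s) * C)"
      using content_remove_word[OF sum that(2)] by (intro mult_left_mono) (auto simp: D_def C_def)
    finally show ?thesis by simp
  qed
  have bA: "bounded A"
    unfolding A_def using word_attractor[of "i # u"] word_attractor[of "j # v"] ij uv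
    by (intro bounded_subset[OF bounded_attractor] Un_least) auto
  define R where "R = (\<Union>k\<in>I - {i, j}. S k ` attractor)"
  have bR: "bounded R"
    unfolding R_def using finite_I bounded_attractor
    by (auto intro!: bounded_UN similitude_bounded_image similitude_S)
  have bS: "bounded (S i ` D u)" "bounded (S j ` D v)"
    using ij bD by (auto intro!: similitude_bounded_image similitude_S)
  have "attractor \<subseteq> A \<union> (S i ` D u \<union> (S j ` D v \<union> R))"
  proof
    fix x assume x: "x \<in> attractor"
    then obtain k y where ky: "k \<in> I" "y \<in> attractor" "x = S k y"
      using attractor_eq by blast
    consider "k = i" | "k = j" | "k \<in> I - {i, j}" using ky by auto
    then show "x \<in> A \<union> (S i ` D u \<union> (S j ` D v \<union> R))"
    proof cases
      case 1
      then show ?thesis using ky unfolding A_def D_def by (cases "y \<in> word_map S u ` attractor") auto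
    next
      case 2
      then show ?thesis using ky unfolding A_def D_def by (cases "y \<in> word_map S v ` attractor") auto
    next
      case 3
      then show ?thesis using ky unfolding R_def by blast
    qed
  qed
  then have "C \<le> ball_content s (A \<union> (S i ` D u \<union> (S j ` D v \<union> R)))"
    unfolding C_def using bA bS bR by (intro ball_content_mono) auto
  also have "\<dots> \<le> ball_content s A + ball_content s (S i ` D u \<union> (S j ` D v \<union> R))"
    using bA bS bR by (intro ball_content_Un_le) auto
  also have "ball_content s (S i ` D u \<union> (S j ` D v \<union> R)) \<le> ball_content s (S i ` D u) + ball_content s (S j ` D v \<union> R)"
    using bS bR by (intro ball_content_Un_le) auto
  also have "ball_content s (S j ` D v \<union> R) \<le> ball_content s (S j ` D v) + ball_content s R"
    using bS bR by (intro ball_content_Un_le) auto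
  also have "ball_content s R \<le> (\<Sum>k\<in>I - {i, j}. ball_content s (S k ` attractor))"
    unfolding R_def using finite_I bounded_attractor
    by (intro ball_content_UN_le) (auto intro!: similitude_bounded_image similitude_S)
  also have "\<dots> \<le> (\<Sum>k\<in>I - {i, j}. r k powr s * C)"
    unfolding C_def by (intro sum_mono ball_content_image_le similitude_S bounded_attractor) auto
  also have "\<dots> = (1 - r i powr s - r j powr s) * C"
  proof -
    have "(\<Sum>k\<in>I - {i, j}. r k powr s) = (\<Sum>k\<in>I. r k powr s) - (\<Sum>k\<in>{i, j}. r k powr s)"
      using finite_I ij by (intro sum_diff) auto
    then show ?thesis
      using sum ij by (simp add: sum_distrib_right[symmetric])
  qed
  finally have "C \<le> ball_content s A + (ball_content s (S i ` D u) + (ball_content s (S j ` D v)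
      + (1 - r i powr s - r j powr s) * C))"
    by simp
  also have "\<dots> \<le> ball_content s A + (r i powr s * (1 - word_ratio r u powr s) * C
      + (r j powr s * (1 - word_ratio r v powr s) * C + (1 - r i powr s - r j powr s) * C))"
    using D_le[OF ij(1) uv(1)] D_le[OF ij(2) uv(2)] by simp
  finally show ?thesis
    using r_pos ij word_ratio_pos uv by (simp add: powr_mult algebra_simps A_def C_def)
qed

section \<open>Nearly coincident pieces\<close>

text \<open>\<open>h\<close> is the neighbour map of the two words, written through a composition so
  that no inverse appears. That the identity is a limit of neighbour maps is the Bandt-Graf
  obstruction to the open set condition. The bound on the ratios keeps the second piece from being
  much smaller than the first.\<close>

definition nearly_coincident :: "nat \<Rightarrow> nat \<Rightarrow> bool" where
  "nearly_coincident i j \<longleftrightarrow> (\<forall>R>0. \<forall>e>0. \<exists>u v h. set u \<subseteq> I \<and> set v \<subseteq> I \<and>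
     word_map S (j # v) = word_map S (i # u) \<circ> h \<and> (\<forall>x. \<bar>x\<bar> \<le> R \<longrightarrow> dist (h x) x < e) \<and>
     word_ratio r (i # u) \<le> 2 * word_ratio r (j # v))"

text \<open>Let f and g = f o h be the two word maps. A point x of the open set \<open>V\<close> has
  h x in \<open>V\<close> when h is close to the identity, so the one point g x = f (h x) lies in
  both images of \<open>V\<close>.\<close>

lemma nearly_coincident_not_osc:
  assumes "i \<in> I" "j \<in> I" "i \<noteq> j" "nearly_coincident i j"
  shows "\<not> open_set_condition I S"
proof
  assume "open_set_condition I S"
  then obtain V where V: "open V" "V \<noteq> {}" "\<And>i. i \<in> I \<Longrightarrow> S i ` V \<subseteq> V"
    "S i ` V \<inter> S j ` V = {}"
    using assms unfolding open_set_condition_def by metis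
  obtain x e where x: "x \<in> V" "0 < e" "ball x e \<subseteq> V"
    using V(1,2) by (metis all_not_in_conv openE)
  \<comment> \<open>The radius is \<open>\<bar>x\<bar> + 1\<close> because it must be positive also
    when x = 0.\<close>
  obtain u v h where uv: "set u \<subseteq> I" "set v \<subseteq> I" "word_map S (j # v) = word_map S (i # u) \<circ> h"
    "\<And>y. \<bar>y\<bar> \<le> \<bar>x\<bar> + 1 \<Longrightarrow> dist (h y) y < e"
    using assms(4) \<open>0 < e\<close> unfolding nearly_coincident_def
    by (metis abs_ge_zero add_nonneg_pos zero_less_one)
  have word: "word_map S w y \<in> V" if "set w \<subseteq> I" "y \<in> V" for w y
    using that V(3) by (induction w) (auto simp: subset_iff)
  have "h x \<in> V"
    using uv(4)[of x] x(3) by (auto simp: dist_commute)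
  then have "word_map S (i # u) (h x) \<in> S i ` V"
    using word[OF uv(1)] by auto
  moreover have "word_map S (i # u) (h x) = word_map S (j # v) x"
    using uv(3) by simp
  moreover have "word_map S (j # v) x \<in> S j ` V"
    using word[OF uv(2) x(1)] by auto
  ultimately show False using V(4) by auto
qed

text \<open>A nearly optimal cover of \<open>K\<close> by finitely many open balls also covers \<open>h(K)\<close> when \<open>h\<close> is
  close to the identity, so its image under \<open>f\<close> covers both \<open>f(K)\<close> and \<open>g(K)\<close> for \<open>g = f \<circ> h\<close>,
  at the price of one of them.\<close>

lemma nearly_coincident_content_eq_0:
  assumes "i \<in> I" "j \<in> I" "i \<noteq> j" "nearly_coincident i j"
    and sum: "(\<Sum>i\<in>I. r i powr s) = 1" and "0 \<le> s"
  shows "ball_content s attractor = 0"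
proof (rule ccontr)
  define C where "C = ball_content s attractor"
  assume "ball_content s attractor \<noteq> 0"
  then have C: "0 < C"
    using ball_content_nonneg[OF bounded_attractor, of s] by (simp add: C_def)
  \<comment> \<open>By \<open>a / 2 \<le> b\<close> the second piece has at least the fraction
    \<open>(1 / 2) powr s\<close> of the share of the first, twice what an excess of \<eta> can pay
    for.\<close>
  define \<eta> where "\<eta> = (1 / 2) powr s / 2"
  have \<eta>: "0 < \<eta>" by (simp add: \<eta>_def)
  have "ball_content s attractor < (1 + \<eta>) * C"
    using C \<eta> by (simp add: C_def)
  then obtain L where L: "ball_cover L attractor" "ball_cost s L < (1 + \<eta>) * C"
    using ball_content_approx[OF bounded_attractor] by blast
  define W where "W = (\<Union>p\<in>set L. ball (fst p) (snd p))"
  have "open W" "attractor \<subseteq> W"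
    using L(1) by (auto simp: W_def ball_cover_def)
  then obtain e where e: "0 < e" "(\<Union>x\<in>attractor. ball x e) \<subseteq> W"
    using compact_subset_open_imp_ball_epsilon_subset[OF compact_attractor] by blast
  obtain u v h where uv: "set u \<subseteq> I" "set v \<subseteq> I" "word_map S (j # v) = word_map S (i # u) \<circ> h"
    and h: "\<And>y. \<bar>y\<bar> \<le> 1 \<Longrightarrow> dist (h y) y < e"
    and ratio: "word_ratio r (i # u) \<le> 2 * word_ratio r (j # v)"
    using assms(4) \<open>0 < e\<close> unfolding nearly_coincident_def
    by (metis zero_less_one)
  define a b where "a = word_ratio r (i # u)" and "b = word_ratio r (j # v)"
  have ab: "0 < a" "0 < b" "a / 2 \<le> b"
    using word_ratio_pos[of "i # u"] word_ratio_pos[of "j # v"] uv ratio assms by (auto simp: a_def b_def)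
  have "ball_cover L (attractor \<union> h ` attractor)"
  proof -
    have "h x \<in> W" if "x \<in> attractor" for x
    proof -
      have "\<bar>x\<bar> \<le> 1" using that attractor_subset by auto
      then have "h x \<in> ball x e" using h by (simp add: dist_commute)
      then show ?thesis using e(2) that by blast
    qed
    then show ?thesis
      using L(1) by (auto simp: ball_cover_def W_def)
  qed
  from ball_cover_image[OF similitude_word[of "i # u"] this]
  have cov: "ball_cover (map (\<lambda>p. (word_map S (i # u) (fst p), a * snd p)) L)
      (word_map S (i # u) ` attractor \<union> word_map S (j # v) ` attractor)"
    using uv assms unfolding a_def by (simp add: image_Un image_comp)
  \<comment> \<open>The left side is what two pieces with different first letters must cost, the
    right side the cost of the scaled cover.\<close>
  have "(a powr s + b powr s) * C \<le> a powr s * ball_cost s L"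
    using order_trans[OF content_two_words_ge[OF sum assms(1-3) uv(1,2)] ball_content_le[OF cov]]
      ball_cost_image[OF ab(1) L(1), of s "word_map S (i # u)"]
    by (simp add: a_def b_def C_def)
  also have "\<dots> \<le> a powr s * ((1 + \<eta>) * C)"
    using L(2) by (intro mult_left_mono) auto
  finally have "b powr s * C \<le> a powr s * \<eta> * C"
    by (simp add: algebra_simps)
  then have "b powr s \<le> a powr s * \<eta>"
    using C by simp
  moreover have "a powr s * (1 / 2) powr s \<le> b powr s"
    using powr_mono2[OF \<open>0 \<le> s\<close> _ ab(3)] ab by (simp add: powr_divide)
  moreover have "a powr s * \<eta> < a powr s * (1 / 2) powr s"
    using ab by (simp add: \<eta>_def)
  ultimately show False by linarith
qed

section \<open>Positive content, total disconnectedness, similarity dimension\<close>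

text \<open>The final letter \<open>k\<close> makes the pieces disjoint and costs only the fixed
  factor \<open>r k powr t\<close>, which the powers of the sum outgrow. Disjoint compact pieces
  have positive distance, so \<open>ball_cost_ge_separated\<close> bounds the cost of every cover
  from below.\<close>

lemma content_pos_if_disjoint_words:
  assumes "0 < t" and sum: "1 < (\<Sum>i\<in>I. r i powr t)" and "k \<in> I"
    and disj: "\<And>x y. set x \<subseteq> I \<Longrightarrow> set y \<subseteq> I \<Longrightarrow> length x = length y \<Longrightarrow> x \<noteq> y \<Longrightarrow>
      word_map S (x @ [k]) ` attractor \<inter> word_map S (y @ [k]) ` attractor = {}"
  shows "0 < ball_content t attractor"
proof -
  define P where "P = (\<Sum>i\<in>I. r i powr t)"
  have P: "1 < P" using sum by (simp add: P_def)
  obtain m where m: "1 / r k powr t < P ^ m"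
    using real_arch_pow[OF P] by blast
  \<comment> \<open>The successor ensures \<open>1 \<le> n\<close>, so that there are at least two
    words.\<close>
  define n where "n = Suc m"
  have "P ^ m \<le> P ^ n"
    unfolding n_def using P by (intro power_increasing) auto
  then have n: "1 \<le> n" "1 / r k powr t \<le> P ^ n"
    using m by (auto simp: n_def)
  define J where "J = words I n"
  define f where "f x = word_map S (x @ [k])" for x
  define c where "c x = word_ratio r (x @ [k])" for x
  have J: "finite J" using finite_words finite_I by (simp add: J_def)
  have JI: "set (x @ [k]) \<subseteq> I" if "x \<in> J" for x
    using that \<open>k \<in> I\<close> by (auto simp: J_def words_def)
  have "2 \<le> card J"
    unfolding J_def card_words[OF finite_I] using self_le_power[of "card I" n] card_I n(1) by linarith
  have "\<exists>\<delta>>0. \<forall>i\<in>J. \<forall>j\<in>J. i \<noteq> j \<longrightarrow> (\<forall>x\<in>f i ` attractor. \<forall>y\<in>f j ` attractor. \<delta> \<le> dist x y)"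
  proof -
    have "\<exists>\<delta>>0. p \<in> J \<times> J \<longrightarrow> fst p \<noteq> snd p \<longrightarrow>
      (\<forall>x\<in>f (fst p) ` attractor. \<forall>y\<in>f (snd p) ` attractor. \<delta> \<le> dist x y)" for p
    proof (cases "p \<in> J \<times> J \<and> fst p \<noteq> snd p")
      case True
      then obtain i j where p: "p = (i, j)" "i \<in> J" "j \<in> J" "i \<noteq> j" by (cases p) auto
      have "f i ` attractor \<inter> f j ` attractor = {}"
        using p(2-4) unfolding f_def J_def words_def by (intro disj) auto
      then show ?thesis
        using separate_compact_closed[OF compact_word[OF JI[OF p(2)]]
            compact_imp_closed[OF compact_word[OF JI[OF p(3)]]]] p(1)
        unfolding f_def by auto
    qed (auto intro: exI[of _ 1])
    then obtain d where d: "\<And>p. 0 < d p" "\<And>p. p \<in> J \<times> J \<Longrightarrow> fst p \<noteq> snd p \<Longrightarrow>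
      (\<forall>x\<in>f (fst p) ` attractor. \<forall>y\<in>f (snd p) ` attractor. d p \<le> dist x y)"
      by metis
    define \<delta> where "\<delta> = Min (insert 1 (d ` (J \<times> J)))"
    have "0 < \<delta>"
      using J d(1) by (simp add: \<delta>_def)
    moreover have "\<delta> \<le> d (i, j)" if "i \<in> J" "j \<in> J" for i j
      unfolding \<delta>_def using J that by (intro Min_le) auto
    moreover have "d (i, j) \<le> dist x y"
      if "i \<in> J" "j \<in> J" "i \<noteq> j" "x \<in> f i ` attractor" "y \<in> f j ` attractor" for i j x y
      using d(2)[of "(i, j)"] that by auto
    ultimately show ?thesis
      by (meson order_trans)
  qed
  then obtain \<delta> where \<delta>0: "0 < \<delta>"
    and "\<forall>i\<in>J. \<forall>j\<in>J. i \<noteq> j \<longrightarrow> (\<forall>x\<in>f i ` attractor. \<forall>y\<in>f j ` attractor. \<delta> \<le> dist x y)"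
    by (elim exE conjE)
  then have "\<delta> \<le> dist x y"
    if "i \<in> J" "j \<in> J" "i \<noteq> j" "x \<in> f i ` attractor" "y \<in> f j ` attractor" for i j x y
    using that by auto
  note \<delta> = \<delta>0 this
  have "(\<Sum>x\<in>J. c x powr t) = (\<Sum>x\<in>J. word_ratio r x powr t * r k powr t)"
    using r_pos[OF \<open>k \<in> I\<close>] JI word_ratio_pos
    by (intro sum.cong) (auto simp: c_def word_ratio_append powr_mult less_imp_le)
  also have "\<dots> = P ^ n * r k powr t"
    unfolding J_def P_def sum_distrib_right[symmetric] by (subst sum_words_powr) (auto simp: r_pos)
  finally have ge1: "1 \<le> (\<Sum>x\<in>J. c x powr t)"
    using n(2) r_pos[OF \<open>k \<in> I\<close>] by (simp add: field_simps)
  have lower: "(\<delta> / 2) powr t \<le> ball_cost t L" if "ball_cover L attractor" for L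
  proof (rule ball_cost_ge_separated[OF J \<open>2 \<le> card J\<close> attractor_nonempty \<open>0 < t\<close> _ _ _ \<delta> ge1 that])
    fix x assume "x \<in> J"
    note * = JI[OF this]
    show "similitude (f x) (c x)" "surj (f x)" "f x ` attractor \<subseteq> attractor"
      unfolding f_def c_def by (rule similitude_word[OF *] surj_word[OF *] word_attractor[OF *])+
  qed
  show ?thesis
  proof (rule ccontr)
    assume "\<not> ?thesis"
    moreover have "0 < (\<delta> / 2) powr t" using \<delta>(1) by simp
    ultimately have "ball_content t attractor < (\<delta> / 2) powr t" by linarith
    then obtain L where "ball_cover L attractor" "ball_cost t L < (\<delta> / 2) powr t"
      using ball_content_approx[OF bounded_attractor] by blast
    then show False using lower by fastforce
  qed
qed

text \<open>Self-similarity with ratios of sum below 1 makes the one-dimensional content vanish,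
  whereas covering an interval of length b - a costs at least (b - a) / 2. A connected set of reals
  with two points contains such an interval.\<close>

lemma totally_disconnected_attractor:
  assumes "(\<Sum>i\<in>I. r i) < 1" shows "totally_disconnected attractor"
proof -
  define C where "C = ball_content 1 attractor"
  have "C \<le> (\<Sum>i\<in>I. ball_content 1 (S i ` attractor))"
    unfolding C_def by (subst attractor_eq)
      (intro ball_content_UN_le finite_I similitude_bounded_image[OF similitude_S] bounded_attractor)
  also have "\<dots> \<le> (\<Sum>i\<in>I. r i powr 1 * C)"
    unfolding C_def by (intro sum_mono ball_content_image_le similitude_S bounded_attractor)
  also have "\<dots> = (\<Sum>i\<in>I. r i) * C"
    unfolding sum_distrib_right using r_pos by (intro sum.cong) (auto simp: less_imp_le)
  finally have "(1 - (\<Sum>i\<in>I. r i)) * C \<le> 0" by (simp add: algebra_simps)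
  then have C: "C \<le> 0"
    using assms by (simp add: mult_le_0_iff)
  have False if ab: "a < b" "{a..b} \<subseteq> attractor" for a b
  proof -
    have "ball_content 1 attractor < (b - a) / 2" using C ab(1) by (simp add: C_def)
    then obtain L where L: "ball_cover L attractor" "ball_cost 1 L < (b - a) / 2"
      using ball_content_approx[OF bounded_attractor] by blast
    have "b - a = measure lborel {a..b}" using ab(1) by simp
    also have "\<dots> \<le> measure lborel (\<Union>n\<in>{..<length L}. ball (fst (L ! n)) (snd (L ! n)))"
    proof (rule measure_mono_fmeasurable)
      show "{a..b} \<subseteq> (\<Union>n\<in>{..<length L}. ball (fst (L ! n)) (snd (L ! n)))"
      proof
        fix x assume "x \<in> {a..b}"
        then have "x \<in> attractor" using ab(2) by blast
        then obtain p where p: "p \<in> set L" "x \<in> ball (fst p) (snd p)"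
          using L(1) by (auto simp: ball_cover_def)
        then obtain n where "n < length L" "L ! n = p"
          by (auto simp: in_set_conv_nth)
        then show "x \<in> (\<Union>n\<in>{..<length L}. ball (fst (L ! n)) (snd (L ! n)))"
          using p(2) by blast
      qed
      show "(\<Union>n\<in>{..<length L}. ball (fst (L ! n)) (snd (L ! n))) \<in> fmeasurable lborel"
        by (intro fmeasurable.finite_UN) (auto intro!: fmeasurableI emeasure_bounded_finite)
    qed simp
    also have "\<dots> \<le> (\<Sum>n<length L. measure lborel (ball (fst (L ! n)) (snd (L ! n))))"
      by (intro measure_UNION_le) auto
    also have "\<dots> = (\<Sum>n<length L. 2 * snd (L ! n) powr 1)"
      using L(1) by (intro sum.cong) (auto simp: ball_eq_greaterThanLessThan ball_cover_def less_imp_le)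
    also have "\<dots> = 2 * ball_cost 1 L"
      unfolding ball_cost_def sum_list_sum_nth sum_distrib_left
      by (intro sum.cong) auto
    finally show False using L(2) by simp
  qed
  then show ?thesis
    unfolding totally_disconnected_def
    by (metis connected_contains_Icc insert_iff linorder_neqE_linordered_idom order_trans subsetI)
qed

text \<open>The power sum is strictly decreasing in the exponent, equals \<open>card I\<close> at 0
  and is below 1 at 1. So the description in \<open>sim_dim\<close> has exactly one
  solution.\<close>

lemma sim_dim_properties:
  assumes "(\<Sum>i\<in>I. r i) < 1"
  shows "0 < sim_dim I r" "(\<Sum>i\<in>I. r i powr sim_dim I r) = 1"
    "\<And>t. t < sim_dim I r \<Longrightarrow> 1 < (\<Sum>i\<in>I. r i powr t)"
proof -
  define g where "g s = (\<Sum>i\<in>I. r i powr s)" for s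
  have anti: "g y < g x" if "x < y" for x y
    unfolding g_def using that r_pos r_less_1 finite_I I_nonempty
    by (intro sum_strict_mono) (auto intro!: powr_less_mono')
  have "g 0 = (\<Sum>i\<in>I. 1)"
    unfolding g_def using r_pos by (intro sum.cong) (auto simp: less_imp_neq[symmetric])
  then have g0: "1 < g 0"
    using card_I by simp
  have g1: "g 1 < 1"
    using assms r_pos by (simp add: g_def less_imp_le)
  have "continuous_on {0..1} g"
    unfolding g_def using r_pos by (intro continuous_intros) (auto simp: less_imp_neq[symmetric])
  then obtain s where s: "0 \<le> s" "g s = 1"
    using IVT2'[of g 1 1 0] g0 g1 by auto
  have uniq: "s' = s" if "g s' = 1" for s'
    using anti[of s s'] anti[of s' s] that s by (cases s s' rule: linorder_cases) auto
  have "sim_dim I r = s"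
    unfolding sim_dim_def g_def[symmetric] using s(2) uniq by (rule the_equality)
  then show "0 < sim_dim I r" "(\<Sum>i\<in>I. r i powr sim_dim I r) = 1"
    "\<And>t. t < sim_dim I r \<Longrightarrow> 1 < (\<Sum>i\<in>I. r i powr t)"
    using s g0 anti[of _ s] by (auto simp: g_def order_less_le)
qed

end

section \<open>The six maps\<close>

text \<open>Maps 1 and 6 fix the end points, with ratios 1/64 and 1/81; maps 3 and 4 carry 0 and 1
  to 1/2. Maps 2 and 5 mirror each other, \<open>six_map l 5 x = 1 - six_map l 2 x\<close>. Hence
  the words 3 1^n 2 and 4 6^m 5 both act as 1/2 + q (1/3 + x/64) and differ only in the scale
  q.\<close>

definition six_map :: "real \<Rightarrow> nat \<Rightarrow> real \<Rightarrow> real" where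
  "six_map l i x =
    (if i = 1 then x / 64 else if i = 2 then 1 / 3 + x / 64 else if i = 3 then 1 / 2 + l * x
     else if i = 4 then 1 / 2 + (1 - x) / 100 else if i = 5 then 2 / 3 - x / 64
     else 1 - (1 - x) / 81)"

definition six_ratio :: "real \<Rightarrow> nat \<Rightarrow> real" where
  "six_ratio l i = (if i = 3 then l else if i = 4 then 1 / 100 else if i = 6 then 1 / 81 else 1 / 64)"

lemma one_to_six: "i \<in> {1..6} \<longleftrightarrow> i = 1 \<or> i = 2 \<or> i = 3 \<or> i = 4 \<or> i = 5 \<or> i = (6 :: nat)"
  by auto

text \<open>The parameter interval has positive length, as the null set argument needs. It keeps all
  ratios at most 1/64 and puts \<open>100 * l\<close> between 1/2 and 1, the range required in
  \<open>powers_nearly_equal\<close>.\<close>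

locale six_maps =
  fixes l :: real
  assumes l_ge: "1 / 200 \<le> l" and l_le: "l \<le> 1 / 100"
begin

lemma six_map_unit:
  assumes "x \<in> {0..1}" "i \<in> {1..6}" shows "six_map l i x \<in> {0..1}"
proof -
  have "0 \<le> l * x" "l * x \<le> 1 / 100"
    using assms(1) l_ge l_le mult_mono[of l "1 / 100" x 1] by auto
  then show ?thesis
    using assms unfolding one_to_six by (auto simp: six_map_def field_simps)
qed

end

sublocale six_maps \<subseteq> unit_ifs "{1..6}" "six_map l" "six_ratio l"
proof
  fix i :: nat assume i: "i \<in> {1..6}"
  have l0: "0 < l" using l_ge by linarith
  have ratio: "0 < six_ratio l i" "six_ratio l i < 1"
    using l0 l_le by (auto simp: six_ratio_def)
  have "six_map l i x - six_map l i y = six_ratio l i * (x - y)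
      \<or> six_map l i x - six_map l i y = six_ratio l i * (y - x)" for x y
    using i unfolding one_to_six
    by (elim disjE) (simp_all add: six_map_def six_ratio_def field_simps)
  then have "dist (six_map l i x) (six_map l i y) = six_ratio l i * dist x y" for x y
    unfolding dist_real_def using ratio(1) by (metis abs_minus_commute abs_mult abs_of_pos)
  with ratio show "contr_sim (six_map l i) (six_ratio l i)"
    by (simp add: contr_sim_def)
  have "\<exists>x. six_map l i x = y" for y
    using i unfolding one_to_six
  proof (elim disjE)
    assume "i = 1" then show ?thesis by (intro exI[of _ "64 * y"]) (simp add: six_map_def field_simps)
  next
    assume "i = 2" then show ?thesis by (intro exI[of _ "64 * (y - 1 / 3)"]) (simp add: six_map_def field_simps)
  next
    assume "i = 3" then show ?thesis using l0 by (intro exI[of _ "(y - 1 / 2) / l"]) (simp add: six_map_def field_simps)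
  next
    assume "i = 4" then show ?thesis by (intro exI[of _ "1 - 100 * (y - 1 / 2)"]) (simp add: six_map_def field_simps)
  next
    assume "i = 5" then show ?thesis by (intro exI[of _ "64 * (2 / 3 - y)"]) (simp add: six_map_def field_simps)
  next
    assume "i = 6" then show ?thesis by (intro exI[of _ "1 - 81 * (1 - y)"]) (simp add: six_map_def field_simps)
  qed
  then show "surj (six_map l i)" unfolding surj_def by metis
  show "six_map l i ` {0..1} \<subseteq> {0..1}"
    using six_map_unit i by blast
qed auto

section \<open>Position of the pieces and behaviour at the end points\<close>

context six_maps
begin

lemma six_map_bounds:
  assumes "x \<in> {0..1}" "i \<in> {1..6}"
  shows "i = 1 \<Longrightarrow> 0 \<le> six_map l i x \<and> six_map l i x \<le> 1 / 64"
    and "i = 2 \<Longrightarrow> 1 / 3 \<le> six_map l i x \<and> six_map l i x \<le> 1 / 3 + 1 / 64"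
    and "i = 3 \<Longrightarrow> 1 / 2 \<le> six_map l i x \<and> six_map l i x \<le> 1 / 2 + 1 / 100"
    and "i = 4 \<Longrightarrow> 1 / 2 \<le> six_map l i x \<and> six_map l i x \<le> 1 / 2 + 1 / 100"
    and "i = 5 \<Longrightarrow> 2 / 3 - 1 / 64 \<le> six_map l i x \<and> six_map l i x \<le> 2 / 3"
    and "i = 6 \<Longrightarrow> 1 - 1 / 81 \<le> six_map l i x \<and> six_map l i x \<le> 1"
proof -
  have "0 \<le> l * x" "l * x \<le> 1 / 100"
    using assms(1) l_ge l_le mult_mono[of l "1 / 100" x 1] by auto
  then show "i = 3 \<Longrightarrow> 1 / 2 \<le> six_map l i x \<and> six_map l i x \<le> 1 / 2 + 1 / 100"
    by (simp add: six_map_def)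
qed (use assms in \<open>auto simp: six_map_def\<close>)

lemma six_map_ge_third: "x \<in> {0..1} \<Longrightarrow> i \<in> {1..6} \<Longrightarrow> i \<noteq> 1 \<Longrightarrow> 1 / 3 \<le> six_map l i x"
  using six_map_bounds[of x i] unfolding one_to_six by (elim disjE) simp_all

lemma six_map_le_two_thirds: "x \<in> {0..1} \<Longrightarrow> i \<in> {1..6} \<Longrightarrow> i \<noteq> 6 \<Longrightarrow> six_map l i x \<le> 2 / 3"
  using six_map_bounds[of x i] unfolding one_to_six by (elim disjE) simp_all

lemma six_map_eq_0:
  assumes "x \<in> {0..1}" "i \<in> {1..6}" "six_map l i x = 0" shows "i = 1 \<and> x = 0"
  using six_map_ge_third[OF assms(1,2)] assms(3) by (cases "i = 1") (auto simp: six_map_def)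

lemma six_map_eq_1:
  assumes "x \<in> {0..1}" "i \<in> {1..6}" "six_map l i x = 1" shows "i = 6 \<and> x = 1"
  using six_map_le_two_thirds[OF assms(1,2)] assms(3) by (cases "i = 6") (auto simp: six_map_def)

lemma six_map_eq_half:
  assumes "x \<in> {0..1}" "i \<in> {1..6}" "six_map l i x = 1 / 2"
  shows "i = 3 \<and> x = 0 \<or> i = 4 \<and> x = 1"
proof -
  have "i = 3 \<or> i = 4"
    using assms six_map_bounds[OF assms(1,2)] unfolding one_to_six by (elim disjE) simp_all
  then show ?thesis
    using assms(3) l_ge by (auto simp: six_map_def)
qed

lemma six_map_disjoint:
  assumes "x \<in> {0..1}" "y \<in> {0..1}" "i \<in> {1..6}" "j \<in> {1..6}" "six_map l i x = six_map l j y"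
  shows "i = j \<or> {i, j} = {3, 4}"
proof -
  \<comment> \<open>\<open>c\<close> reads the first letter off the position: the thresholds
    separate the five intervals that contain the pieces, and the letters 3 and 4 share the value
    3.\<close>
  define c :: "real \<Rightarrow> nat" where
    "c z = (if z < 1 / 4 then 1 else if z < 2 / 5 then 2 else if z < 3 / 5 then 3
            else if z < 3 / 4 then 5 else 6)" for z
  have "c (six_map l k z) = (if k = 4 then 3 else k)" if "z \<in> {0..1}" "k \<in> {1..6}" for k z
    using six_map_bounds[OF that] that(2) unfolding one_to_six c_def by (elim disjE) simp_all
  from this[OF assms(1,3)] this[OF assms(2,4)] show ?thesis
    using assms(5) by (auto split: if_splits)
qed

text \<open>On the unit interval only map 1 takes the value 0, and only at 0. So every address of 0
  is constantly 1; \<open>word_eq_1\<close> is the mirror image at the other end.\<close>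

lemma word_eq_0:
  assumes "set w \<subseteq> {1..6}" "x \<in> {0..1}" "word_map (six_map l) w x = 0"
  shows "(\<forall>i\<in>set w. i = 1) \<and> x = 0"
  using assms
proof (induction w)
  case (Cons i w)
  then have "i = 1 \<and> word_map (six_map l) w x = 0"
    using six_map_eq_0[of "word_map (six_map l) w x" i] word_unit[of w x] by auto
  then show ?case using Cons by auto
qed simp

lemma word_eq_1:
  assumes "set w \<subseteq> {1..6}" "x \<in> {0..1}" "word_map (six_map l) w x = 1"
  shows "(\<forall>i\<in>set w. i = 6) \<and> x = 1"
  using assms
proof (induction w)
  case (Cons i w)
  then have "i = 6 \<and> word_map (six_map l) w x = 1"
    using six_map_eq_1[of "word_map (six_map l) w x" i] word_unit[of w x] by auto
  then show ?case using Cons by auto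
qed simp

lemma zero_in_attractor: "0 \<in> attractor"
  by (rule fixed_point_in_attractor[of 1]) (auto simp: six_map_def)

lemma one_in_attractor: "1 \<in> attractor"
  by (rule fixed_point_in_attractor[of 6]) (auto simp: six_map_def)

lemma attractor_unit: "x \<in> attractor \<Longrightarrow> x \<in> {0..1}"
  using attractor_subset by blast

text \<open>Removing the leading letters 1 exposes the scale of a point near 0: what remains lies in
  a piece that stays away from 0.\<close>

lemma attractor_scale_0:
  assumes "y \<in> attractor" "y \<noteq> 0"
  obtains n a where "a \<in> (\<Union>i\<in>{1..6} - {1}. six_map l i ` attractor)" "y = (1 / 64) ^ n * a"
proof -
  \<comment> \<open>The lower bound on \<open>y\<close> makes the removal stop after fewer than
    \<open>k\<close> letters.\<close>
  have *: "\<exists>n a. a \<in> (\<Union>i\<in>{1..6} - {1}. six_map l i ` attractor) \<and> y = (1 / 64) ^ n * a"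
    if "y \<in> attractor" "(1 / 64) ^ k < y" for y k
    using that
  proof (induction k arbitrary: y)
    case 0
    then show ?case using attractor_unit by fastforce
  next
    case (Suc k)
    obtain i z where iz: "i \<in> {1..6}" "z \<in> attractor" "y = six_map l i z"
      using Suc.prems(1) attractor_eq by blast
    show ?case
    proof (cases "i = 1")
      case True
      then have y: "y = z / 64" using iz by (simp add: six_map_def)
      then obtain n a where "a \<in> (\<Union>i\<in>{1..6} - {1}. six_map l i ` attractor)" "z = (1 / 64) ^ n * a"
        using Suc.IH[OF iz(2)] Suc.prems(2) by auto
      then show ?thesis
        using y by (intro exI[of _ "Suc n"] exI[of _ a]) simp
    next
      case False
      then show ?thesis using iz by (intro exI[of _ 0] exI[of _ y]) auto
    qed
  qed
  have "0 < y" using attractor_unit[OF assms(1)] assms(2) by simp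
  then obtain k where "(1 / 64) ^ k < y"
    using real_arch_pow_inv[of y "1 / 64"] by auto
  from *[OF assms(1) this] show thesis using that by blast
qed

lemma attractor_scale_1:
  assumes "y \<in> attractor" "y \<noteq> 1"
  obtains n b where "b \<in> (\<Union>i\<in>{1..6} - {6}. six_map l i ` attractor)" "1 - y = (1 / 81) ^ n * (1 - b)"
proof -
  have *: "\<exists>n b. b \<in> (\<Union>i\<in>{1..6} - {6}. six_map l i ` attractor) \<and> 1 - y = (1 / 81) ^ n * (1 - b)"
    if "y \<in> attractor" "(1 / 81) ^ k < 1 - y" for y k
    using that
  proof (induction k arbitrary: y)
    case 0
    then show ?case using attractor_unit by fastforce
  next
    case (Suc k)
    obtain i z where iz: "i \<in> {1..6}" "z \<in> attractor" "y = six_map l i z"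
      using Suc.prems(1) attractor_eq by blast
    show ?case
    proof (cases "i = 6")
      case True
      then have y: "1 - y = (1 - z) / 81" using iz by (simp add: six_map_def)
      then obtain n b where "b \<in> (\<Union>i\<in>{1..6} - {6}. six_map l i ` attractor)" "1 - z = (1 / 81) ^ n * (1 - b)"
        using Suc.IH[OF iz(2)] Suc.prems(2) by auto
      then show ?thesis
        using y by (intro exI[of _ "Suc n"] exI[of _ b]) simp
    next
      case False
      then show ?thesis using iz by (intro exI[of _ 0] exI[of _ y]) auto
    qed
  qed
  have "0 < 1 - y" using attractor_unit[OF assms(1)] assms(2) by simp
  then obtain k where "(1 / 81) ^ k < 1 - y"
    using real_arch_pow_inv[of "1 - y" "1 / 81"] by auto
  from *[OF assms(1) this] show thesis using that by blast
qed

lemma word_ratio_le: "set w \<subseteq> {1..6} \<Longrightarrow> word_ratio (six_ratio l) w \<le> (1 / 64) ^ length w"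
proof (induction w)
  case (Cons i w)
  have "six_ratio l i \<le> 1 / 64" using l_le by (simp add: six_ratio_def)
  then have "six_ratio l i * word_ratio (six_ratio l) w \<le> 1 / 64 * (1 / 64) ^ length w"
    using Cons word_ratio_pos[of w] by (intro mult_mono) auto
  then show ?case by simp
qed simp

text \<open>The attractor depends on \<open>l\<close> in a complicated way, but for a fixed word the
  image of 0 is an explicit function of \<open>l\<close>. At each level finitely many such functions
  replace all points of the attractor.\<close>

lemma attractor_approx:
  assumes "i \<in> {1..6}" "a \<in> six_map l i ` attractor"
  obtains u where "u \<in> words {1..6} (Suc N)" "hd u = i"
    "\<bar>a - word_map (six_map l) u 0\<bar> \<le> (1 / 64) ^ Suc N"
proof -
  obtain y where y: "y \<in> attractor" "a = six_map l i y"
    using assms(2) by blast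
  then have "y \<in> (\<Union>w\<in>words {1..6} N. word_map (six_map l) w ` attractor)"
    using attractor_words[of N] by simp
  then obtain w z where w: "w \<in> words {1..6} N"
    and z: "z \<in> attractor" "a = six_map l i (word_map (six_map l) w z)"
    using y(2) by blast
  have u: "i # w \<in> words {1..6} (Suc N)"
    using w assms(1) by (auto simp: words_def)
  then have sub: "set (i # w) \<subseteq> {1..6}" and len: "length (i # w) = Suc N"
    unfolding words_def by auto
  have "dist (word_map (six_map l) (i # w) z) (word_map (six_map l) (i # w) 0)
      = word_ratio (six_ratio l) (i # w) * dist z 0"
    using similitude_word[OF sub] unfolding similitude_def by blast
  then have "\<bar>a - word_map (six_map l) (i # w) 0\<bar> = word_ratio (six_ratio l) (i # w) * \<bar>z\<bar>"
    using z(2) by (simp add: dist_real_def)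
  also have "\<dots> \<le> (1 / 64) ^ Suc N * 1"
    using word_ratio_le[OF sub] len attractor_unit[OF z(1)] by (intro mult_mono) auto
  finally show thesis
    using u by (intro that[of "i # w"]) auto
qed

end

section \<open>Transversality in the parameter\<close>

text \<open>The parameter enters only through map 3, which adds at most
  \<open>\<bar>l - l'\<bar>\<close> and damps the inherited change by 1/100. The constant 2 survives
  because 1 + 2/100 \<le> 2; the other maps only contract.\<close>

lemma word_map_lipschitz_param:
  assumes "six_maps l" "six_maps l'" "set w \<subseteq> {1..6}"
  shows "\<bar>word_map (six_map l) w 0 - word_map (six_map l') w 0\<bar> \<le> 2 * \<bar>l - l'\<bar>"
  using assms(3)
proof (induction w)
  case (Cons i w)
  interpret A: six_maps l by fact
  interpret B: six_maps l' by fact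
  define x y where "x = word_map (six_map l) w 0" and "y = word_map (six_map l') w 0"
  have xy: "\<bar>x - y\<bar> \<le> 2 * \<bar>l - l'\<bar>" using Cons by (simp add: x_def y_def)
  have x01: "x \<in> {0..1}" unfolding x_def by (rule A.word_unit) (use Cons in auto)
  have "\<bar>six_map l i x - six_map l' i y\<bar> \<le> 2 * \<bar>l - l'\<bar>"
  proof (cases "i = 3")
    case True
    have "\<bar>(l - l') * x\<bar> \<le> \<bar>l - l'\<bar> * 1"
      unfolding abs_mult using x01 by (intro mult_left_mono) auto
    moreover have "\<bar>l' * (x - y)\<bar> \<le> 1 / 100 * (2 * \<bar>l - l'\<bar>)"
      unfolding abs_mult using B.l_ge B.l_le xy by (intro mult_mono) auto
    moreover have "six_map l i x - six_map l' i y = (l - l') * x + l' * (x - y)"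
      using True by (simp add: six_map_def algebra_simps)
    ultimately show ?thesis by linarith
  next
    case False
    then show ?thesis using xy by (auto simp: six_map_def simp flip: diff_divide_distrib)
  qed
  then show ?case by (simp add: x_def y_def)
qed simp

text \<open>With \<open>l\<close> the product \<open>l * a\<close> changes at rate about
  \<open>a\<close>, which is at least 1/3 since the first letter of \<open>u\<close> is not 1. The
  word maps change at rate at most 2 and are damped by the small factors \<open>t\<close> and
  \<open>l'\<close>, so they cannot compensate.\<close>

lemma six_maps_near_solutions:
  fixes l l' t e :: real
  assumes l: "six_maps l" "six_maps l'" and t: "0 < t" "t \<le> 3 / 100"
    and u: "u \<in> words {1..6} (Suc N)" "hd u \<noteq> 1" and v: "v \<in> words {1..6} (Suc N)"
    and e: "\<bar>l * word_map (six_map l) u 0 - t * (1 - word_map (six_map l) v 0)\<bar> \<le> e"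
      "\<bar>l' * word_map (six_map l') u 0 - t * (1 - word_map (six_map l') v 0)\<bar> \<le> e"
  shows "\<bar>l - l'\<bar> \<le> 8 * e"
proof -
  interpret A: six_maps l by fact
  interpret B: six_maps l' by fact
  define a a' b b' where "a = word_map (six_map l) u 0" and "a' = word_map (six_map l') u 0"
    and "b = 1 - word_map (six_map l) v 0" and "b' = 1 - word_map (six_map l') v 0"
  define D where "D = \<bar>l - l'\<bar>"
  have su: "set u \<subseteq> {1..6}" and sv: "set v \<subseteq> {1..6}"
    using u v by (auto simp: words_def)
  have aa: "\<bar>a' - a\<bar> \<le> 2 * D"
    using word_map_lipschitz_param[OF l(2,1) su] by (simp add: a_def a'_def D_def abs_minus_commute)
  have bb: "\<bar>b - b'\<bar> \<le> 2 * D"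
    using word_map_lipschitz_param[OF l(2,1) sv] by (simp add: b_def b'_def D_def abs_minus_commute)
  obtain i w where iw: "u = i # w" using u by (auto simp: words_def length_Suc_conv)
  have "1 / 3 \<le> a"
    using A.six_map_ge_third[of "word_map (six_map l) w 0" i] A.word_unit[of w 0] su u(2) iw
    by (simp add: a_def)
  then have "D * (1 / 3) \<le> D * a"
    by (intro mult_left_mono) (auto simp: D_def)
  also have "\<dots> = \<bar>(l - l') * a\<bar>"
    using \<open>1 / 3 \<le> a\<close> by (simp add: D_def abs_mult)
  also have "(l - l') * a = t * (b - b') + (l * a - t * b) - (l' * a' - t * b') + l' * (a' - a)"
    by (simp add: algebra_simps)
  also have "\<bar>\<dots>\<bar> \<le> \<bar>t * (b - b')\<bar> + \<bar>l * a - t * b\<bar> + \<bar>l' * a' - t * b'\<bar> + \<bar>l' * (a' - a)\<bar>"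
    by linarith
  \<comment> \<open>The small terms take 8/100 of \<open>D\<close> out of the 1/3 on the left; the
    rest is controlled by the two errors \<open>e\<close>.\<close>
  also have "\<dots> \<le> 3 / 100 * (2 * D) + e + e + 1 / 100 * (2 * D)"
  proof (intro add_mono)
    show "\<bar>t * (b - b')\<bar> \<le> 3 / 100 * (2 * D)"
      unfolding abs_mult using t bb by (intro mult_mono) auto
    show "\<bar>l' * (a' - a)\<bar> \<le> 1 / 100 * (2 * D)"
      unfolding abs_mult using B.l_ge B.l_le aa by (intro mult_mono) auto
  qed (use e in \<open>simp_all add: a_def a'_def b_def b'_def\<close>)
  finally have "19 * D \<le> 150 * e" by simp
  moreover have "0 \<le> D" by (simp add: D_def)
  ultimately show ?thesis unfolding D_def[symmetric] by linarith
qed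

text \<open>After removal of the leading letters 1 in piece 3 and 6 in piece 4, a common point of
  these pieces other than 1/2 yields this equation, where \<open>t\<close> compares the two
  scales.\<close>

definition bad_params :: "real \<Rightarrow> real set" where
  "bad_params t = {l \<in> {1 / 200..1 / 100}.
     \<exists>a\<in>(\<Union>i\<in>{1..6} - {1}. six_map l i ` unit_ifs.attractor {1..6} (six_map l)).
     \<exists>b\<in>(\<Union>i\<in>{1..6} - {6}. six_map l i ` unit_ifs.attractor {1..6} (six_map l)).
       l * a = t * (1 - b)}"

text \<open>Transversality: for fixed words the solution \<open>l\<close> moves by at most a constant times the
  error in the equation. At level \<open>M\<close> there are \<open>36 ^ M\<close> pairs of words and the error is
  \<open>64 ^ (- M)\<close>, so the bad parameters form a null set.\<close>

lemma negligible_bad_params: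
  assumes t: "0 < t" shows "negligible (bad_params t)"
proof (cases "t \<le> 3 / 100")
  case False
  \<comment> \<open>For such \<open>t\<close> the two sides cannot agree: the left is at most 1/100,
    the right at least t/3.\<close>
  have "bad_params t = {}"
  proof (rule ccontr)
    assume "bad_params t \<noteq> {}"
    then obtain l a b i j x y where l: "l \<in> {1 / 200..1 / 100}"
      and i: "i \<in> {1..6} - {1}" "x \<in> unit_ifs.attractor {1..6} (six_map l)" "a = six_map l i x"
      and j: "j \<in> {1..6} - {6}" "y \<in> unit_ifs.attractor {1..6} (six_map l)" "b = six_map l j y"
      and eq: "l * a = t * (1 - b)"
      unfolding bad_params_def by blast
    interpret six_maps l by unfold_locales (use l in auto)
    have "a \<le> 1" "0 \<le> a"
      using six_map_unit[OF attractor_unit[OF i(2)], of i] i by auto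
    then have "l * a \<le> 1 / 100 * 1"
      using l by (intro mult_mono) auto
    moreover have "b \<le> 2 / 3"
      using six_map_le_two_thirds[OF attractor_unit[OF j(2)], of j] j by auto
    then have "t * (1 / 3) \<le> t * (1 - b)"
      using t by (intro mult_left_mono) auto
    ultimately show False using eq False by linarith
  qed
  then show ?thesis by simp
next
  case True
  have "\<exists>T. bad_params t \<subseteq> T \<and> T \<in> lmeasurable \<and> measure lebesgue T \<le> e" if "0 < e" for e
  proof -
    \<comment> \<open>The final bound is \<open>16 * (9 / 16) ^ Suc N\<close>, from
      \<open>36 ^ Suc N\<close> pairs of words with an interval of length
      \<open>16 * \<epsilon>\<close> each.\<close>
    obtain N where "(9 / 16 :: real) ^ N < e / 16"
      using real_arch_pow_inv[of "e / 16" "9 / 16"] \<open>0 < e\<close> by auto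
    moreover have "(9 / 16 :: real) ^ Suc N \<le> (9 / 16) ^ N" by simp
    ultimately have N: "(9 / 16 :: real) ^ Suc N < e / 16" by linarith
    define W where "W = words {1..6::nat} (Suc N)"
    define \<epsilon> :: real where "\<epsilon> = (1 / 64) ^ Suc N"
    define B where "B u v = {l \<in> {1 / 200..1 / 100}. hd u \<noteq> 1 \<and>
      \<bar>l * word_map (six_map l) u 0 - t * (1 - word_map (six_map l) v 0)\<bar> \<le> \<epsilon>}" for u v
    have "\<exists>x. B u v \<subseteq> cball x (8 * \<epsilon>)" if "u \<in> W" "v \<in> W" for u v
    proof (cases "B u v = {}")
      case False
      then obtain x where x: "x \<in> B u v" by auto
      have "dist x y \<le> 8 * \<epsilon>" if y: "y \<in> B u v" for y
        unfolding dist_real_def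
        by (rule six_maps_near_solutions[OF _ _ t True \<open>u \<in> W\<close>[unfolded W_def] _ \<open>v \<in> W\<close>[unfolded W_def]])
          (use x y in \<open>auto simp: B_def six_maps_def\<close>)
      then show ?thesis by (intro exI[of _ x]) auto
    qed simp
    then obtain c where c: "\<And>u v. u \<in> W \<Longrightarrow> v \<in> W \<Longrightarrow> B u v \<subseteq> cball (c u v) (8 * \<epsilon>)"
      by metis
    define T where "T = (\<Union>p\<in>W \<times> W. cball (c (fst p) (snd p)) (8 * \<epsilon>))"
    have finW: "finite (W \<times> W)" by (simp add: W_def finite_words)
    have "bad_params t \<subseteq> T"
    proof
      fix l assume "l \<in> bad_params t"
      then obtain a b i j where l: "l \<in> {1 / 200..1 / 100}"
        and i: "i \<in> {1..6} - {1}" "a \<in> six_map l i ` unit_ifs.attractor {1..6} (six_map l)"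
        and j: "j \<in> {1..6} - {6}" "b \<in> six_map l j ` unit_ifs.attractor {1..6} (six_map l)"
        and eq: "l * a = t * (1 - b)"
        unfolding bad_params_def by blast
      interpret six_maps l by unfold_locales (use l in auto)
      obtain u where u: "u \<in> W" "hd u = i" "\<bar>a - word_map (six_map l) u 0\<bar> \<le> \<epsilon>"
        using attractor_approx[OF _ i(2)] i(1) unfolding W_def \<epsilon>_def by blast
      obtain v where v: "v \<in> W" "hd v = j" "\<bar>b - word_map (six_map l) v 0\<bar> \<le> \<epsilon>"
        using attractor_approx[OF _ j(2)] j(1) unfolding W_def \<epsilon>_def by blast
      have "l * word_map (six_map l) u 0 - t * (1 - word_map (six_map l) v 0)
          = - (l * (a - word_map (six_map l) u 0)) - t * (b - word_map (six_map l) v 0)"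
        using eq by (simp add: algebra_simps)
      also have "\<bar>\<dots>\<bar> \<le> \<bar>l * (a - word_map (six_map l) u 0)\<bar> + \<bar>t * (b - word_map (six_map l) v 0)\<bar>"
        by linarith
      also have "\<dots> \<le> 1 / 100 * \<epsilon> + 3 / 100 * \<epsilon>"
        unfolding abs_mult using l t True u(3) v(3) by (intro add_mono mult_mono) auto
      also have "\<dots> \<le> \<epsilon>" by (simp add: \<epsilon>_def)
      finally have "l \<in> B u v"
        using l u(2) i(1) by (simp add: B_def)
      then show "l \<in> T"
        unfolding T_def using c[OF u(1) v(1)] u(1) v(1) by (intro UN_I[of "(u, v)"]) auto
    qed
    moreover have "T \<in> lmeasurable"
      unfolding T_def by (intro fmeasurable.finite_UN finW) auto
    moreover have "measure lebesgue T \<le> e"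
    proof -
      have "measure lebesgue T \<le> (\<Sum>p\<in>W \<times> W. measure lebesgue (cball (c (fst p) (snd p)) (8 * \<epsilon>)))"
        unfolding T_def by (intro measure_UNION_le finW) auto
      also have "\<dots> = (\<Sum>p\<in>W \<times> W. 16 * \<epsilon>)"
        by (intro sum.cong) (auto simp: cball_eq_atLeastAtMost \<epsilon>_def)
      also have "\<dots> = 16 * (9 / 16) ^ Suc N"
      proof -
        have "real (card (W \<times> W)) = 36 ^ Suc N"
          unfolding W_def card_cartesian_product card_words[OF finite_atLeastAtMost]
          by (simp add: power_mult_distrib[symmetric])
        then have "(\<Sum>p\<in>W \<times> W. 16 * \<epsilon>) = 16 * (36 ^ Suc N * (1 / 64) ^ Suc N)"
          by (simp add: \<epsilon>_def del: power_Suc)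
        also have "36 ^ Suc N * (1 / 64) ^ Suc N = (9 / 16 :: real) ^ Suc N"
          unfolding power_mult_distrib[symmetric] by simp
        finally show ?thesis .
      qed
      finally show ?thesis using N by linarith
    qed
    ultimately show ?thesis by blast
  qed
  then show ?thesis by (simp add: negligible_outer_le)
qed

text \<open>Only countably many scales occur, so the bad parameters for all of them together form a
  null set, which cannot fill an interval of positive length.\<close>

lemma exists_good_param:
  obtains l where "six_maps l"
    "six_map l 3 ` unit_ifs.attractor {1..6} (six_map l) \<inter> six_map l 4 ` unit_ifs.attractor {1..6} (six_map l) = {1 / 2}"
proof -
  \<comment> \<open>This is the factor left when l 64^(-n) a = 81^(-m) (1 - b) / 100 is divided by
    64^(-n), with p = (m, n).\<close>
  define t :: "nat \<times> nat \<Rightarrow> real" where "t p = 1 / 100 * (1 / 81) ^ fst p * 64 ^ snd p" for p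
  have "negligible (\<Union>p. bad_params (t p))"
  proof (rule negligible_countable_Union)
    show "countable (range (\<lambda>p. bad_params (t p)))" by (intro countable_image) auto
    show "negligible S" if "S \<in> range (\<lambda>p. bad_params (t p))" for S
      using that by (auto simp: t_def intro!: negligible_bad_params)
  qed
  moreover have "\<not> negligible {1 / 200..1 / 100 :: real}"
    by (simp add: negligible_interval(1)[of "1/200::real" "1/100", simplified cbox_interval])
  ultimately have "\<not> {1 / 200..1 / 100} \<subseteq> (\<Union>p. bad_params (t p))"
    using negligible_subset by blast
  then obtain l where l: "l \<in> {1 / 200..1 / 100}" "\<And>p. l \<notin> bad_params (t p)"
    by blast
  interpret six_maps l by unfold_locales (use l in auto)
  have "six_map l 3 ` attractor \<inter> six_map l 4 ` attractor \<subseteq> {1 / 2}"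
  proof
    fix x assume "x \<in> six_map l 3 ` attractor \<inter> six_map l 4 ` attractor"
    then obtain y z where y: "y \<in> attractor" "x = six_map l 3 y" and z: "z \<in> attractor" "x = six_map l 4 z"
      by auto
    have eq: "l * y = (1 - z) / 100"
      using y z by (simp add: six_map_def)
    have "y = 0"
    proof (rule ccontr)
      assume "y \<noteq> 0"
      then have "z \<noteq> 1" using eq l_ge by auto
      obtain n a where a: "a \<in> (\<Union>i\<in>{1..6} - {1}. six_map l i ` attractor)" "y = (1 / 64) ^ n * a"
        using attractor_scale_0[OF y(1) \<open>y \<noteq> 0\<close>] .
      obtain m b where b: "b \<in> (\<Union>i\<in>{1..6} - {6}. six_map l i ` attractor)" "1 - z = (1 / 81) ^ m * (1 - b)"
        using attractor_scale_1[OF z(1) \<open>z \<noteq> 1\<close>] .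
      have "l * a = t (m, n) * (1 - b)"
        using eq unfolding a(2) b(2) by (simp add: t_def power_divide field_simps)
      then have "l \<in> bad_params (t (m, n))"
        using a(1) b(1) l(1) unfolding bad_params_def by blast
      then show False using l(2) by blast
    qed
    then show "x \<in> {1 / 2}" using y by (simp add: six_map_def)
  qed
  moreover have "1 / 2 \<in> six_map l 3 ` attractor \<inter> six_map l 4 ` attractor"
    using imageI[OF zero_in_attractor, of "six_map l 3"] imageI[OF one_in_attractor, of "six_map l 4"]
    by (simp add: six_map_def)
  ultimately show thesis
    by (intro that[of l]) (auto intro: six_maps_axioms)
qed

section \<open>Nearly equal powers\<close>

text \<open>A rational value would equate a positive power of 81, which is odd and above 1, with a
  power of 64.\<close>

lemma irrational_ln_81_64: "ln 81 / ln 64 \<notin> (\<rat> :: real set)"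
proof
  assume "ln 81 / ln 64 \<in> (\<rat> :: real set)"
  then obtain a b :: nat where ab: "b \<noteq> 0" "\<bar>ln 81 / ln 64 :: real\<bar> = real a / real b"
    by (rule Rats_abs_nat_div_natE)
  have "ln 81 * real b = ln 64 * real a"
    using ab by (simp add: field_simps)
  then have "ln (81 ^ b :: real) = ln (64 ^ a)"
    by (simp add: ln_realpow mult.commute)
  then have "(81 ^ b :: real) = 64 ^ a"
    by (subst (asm) ln_inj_iff) auto
  then have "real (81 ^ b) = real (64 ^ a)" by simp
  then have eq: "(81 ^ b :: nat) = 64 ^ a" by (rule of_nat_eq_iff[THEN iffD1])
  moreover have "odd (81 ^ b :: nat)" by simp
  ultimately have "a = 0" by (cases a) auto
  then show False using eq ab(1) by simp
qed

text \<open>In logarithms, n ln 64 - m ln 81 - ln c has to be close to 0. Density of the fractional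
  parts of the multiples of an irrational number provides integers; the range of \<open>c\<close>
  makes the exponent of 64 non-negative.\<close>

lemma powers_nearly_equal:
  fixes c e :: real
  assumes c: "1 / 2 \<le> c" "c \<le> 1" and "0 < e"
  obtains m n :: nat where "\<bar>(1 / 81) ^ m / (c * (1 / 64) ^ n) - 1\<bar> < e"
proof -
  have "isCont exp (0 :: real)" by simp
  then obtain d where d: "0 < d" "\<And>x :: real. \<bar>x\<bar> < d \<Longrightarrow> \<bar>exp x - 1\<bar> < e"
    using \<open>0 < e\<close> unfolding continuous_at_eps_delta by (force simp: dist_real_def)
  \<comment> \<open>The bound 1/2 settles the sign of \<open>h\<close>, the bound
    \<open>d / ln 64\<close> the final estimate after multiplication by
    \<open>ln 64\<close>.\<close>
  define \<epsilon> where "\<epsilon> = min (1 / 2) (d / ln 64)"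
  have ln64: "0 < ln (64 :: real)" by simp
  have "0 < \<epsilon>" using d(1) by (simp add: \<epsilon>_def)
  then obtain h k :: int where k: "0 < k" "\<bar>k * (ln 81 / ln 64) - h - (- (ln c / ln 64))\<bar> < \<epsilon>"
    using sequence_of_fractional_parts_is_dense[OF irrational_ln_81_64] by blast
  have "0 \<le> h"
  proof -
    have "ln 64 \<le> ln (81 :: real)" by simp
    then have "1 \<le> ln 81 / ln (64 :: real)" using ln64 by simp
    then have "1 * 1 \<le> real_of_int k * (ln 81 / ln 64)"
      using k(1) by (intro mult_mono) auto
    moreover have "- (1 / 6) \<le> ln c / ln 64"
    proof -
      have "ln (64 :: real) = ln (2 ^ 6)" by simp
      also have "\<dots> = 6 * ln 2" by (subst ln_realpow) auto
      finally have "ln (1 / 2) = - (1 / 6) * ln (64 :: real)"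
        by (simp add: ln_div)
      moreover have "ln (1 / 2) \<le> ln c"
        using c by simp
      ultimately show ?thesis using ln64 by (simp add: field_simps)
    qed
    moreover have "\<bar>k * (ln 81 / ln 64) - h - (- (ln c / ln 64))\<bar> < 1 / 2"
      using k(2) unfolding \<epsilon>_def min_less_iff_conj by blast
    ultimately have "- 1 < real_of_int h" by linarith
    then show ?thesis by linarith
  qed
  define m n where "m = nat k" and "n = nat h"
  have mn: "real m = k" "real n = h"
    using k(1) \<open>0 \<le> h\<close> by (auto simp: m_def n_def)
  have "\<bar>real n * ln 64 - real m * ln 81 - ln c\<bar>
      = ln 64 * \<bar>k * (ln 81 / ln 64) - h - (- (ln c / ln 64))\<bar>"
  proof -
    have "real n * ln 64 - real m * ln 81 - ln c
        = - (ln 64 * (k * (ln 81 / ln 64) - h - (- (ln c / ln 64))))"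
      using ln64 unfolding mn by (simp add: field_simps)
    then show ?thesis using ln64 by (simp add: abs_mult del: minus_mult_right)
  qed
  also have "\<dots> < ln 64 * (d / ln 64)"
    using k(2) ln64 by (intro mult_strict_left_mono) (auto simp: \<epsilon>_def)
  finally have "\<bar>real n * ln 64 - real m * ln 81 - ln c\<bar> < d"
    using ln64 by simp
  then have "\<bar>exp (real n * ln 64 - real m * ln 81 - ln c) - 1\<bar> < e"
    by (rule d(2))
  also have "exp (real n * ln 64 - real m * ln 81 - ln c) = (1 / 81) ^ m / (c * (1 / 64) ^ n)"
    using c by (simp add: exp_diff exp_add exp_of_nat_mult power_divide field_simps)
  finally show thesis by (rule that)
qed

context six_maps
begin

lemma word_replicate_1: "word_map (six_map l) (replicate n 1) x = (1 / 64) ^ n * x"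
  by (induction n) (simp_all add: six_map_def)

lemma word_replicate_6: "1 - word_map (six_map l) (replicate n 6) x = (1 / 81) ^ n * (1 - x)"
  by (induction n) (simp_all add: six_map_def)

text \<open>The words 3 1^n 2 and 4 6^m 5 give the same map up to the scale at 1/2, and the quotient
  \<theta> of the two scales can be brought arbitrarily close to 1.\<close>

lemma nearly_coincident_3_4: "nearly_coincident 3 4"
  unfolding nearly_coincident_def
proof (intro allI impI)
  fix R e :: real assume "0 < R" "0 < e"
  \<comment> \<open>The number 22 exceeds 64/3, the constant in the displacement of
    \<open>h\<close>. The bound 1/2 gives \<theta> at least 1/2, hence the factor 2 between the
    ratios.\<close>
  have "0 < min (e / (R + 22)) (1 / 2)" using \<open>0 < R\<close> \<open>0 < e\<close> by simp
  moreover have "1 / 2 \<le> 100 * l" "100 * l \<le> 1" using l_ge l_le by auto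
  ultimately obtain m n where mn:
    "\<bar>(1 / 81) ^ m / (100 * l * (1 / 64) ^ n) - 1\<bar> < min (e / (R + 22)) (1 / 2)"
    using powers_nearly_equal[of "100 * l" "min (e / (R + 22)) (1 / 2)"] by metis
  define \<theta> where "\<theta> = (1 / 81) ^ m / (100 * l * (1 / 64) ^ n)"
  have l0: "0 < l" using l_ge by linarith
  have \<theta>: "(1 / 81) ^ m / 100 = \<theta> * (l * (1 / 64) ^ n)"
    using l0 by (simp add: \<theta>_def)
  define u v where "u = replicate n (1::nat) @ [2]" and "v = replicate m (6::nat) @ [5]"
  \<comment> \<open>The solution of 1/3 + h x / 64 = \<theta> (1/3 + x / 64).\<close>
  define h where "h x = \<theta> * x + (\<theta> - 1) * 64 / 3" for x
  have fu: "word_map (six_map l) (3 # u) x = 1 / 2 + l * (1 / 64) ^ n * (1 / 3 + x / 64)" for x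
    unfolding u_def word_map_append word_map_Cons o_apply word_replicate_1 by (simp add: six_map_def)
  have "word_map (six_map l) (4 # v) x = 1 / 2 + (1 / 81) ^ m / 100 * (1 / 3 + x / 64)" for x
  proof -
    have "word_map (six_map l) (4 # v) x
        = 1 / 2 + (1 - word_map (six_map l) (replicate m 6) (six_map l 5 x)) / 100"
      by (simp add: v_def word_map_append six_map_def[of l 4])
    also have "\<dots> = 1 / 2 + (1 / 81) ^ m / 100 * (1 / 3 + x / 64)"
      unfolding word_replicate_6 by (simp add: six_map_def)
    finally show ?thesis .
  qed
  then have "word_map (six_map l) (4 # v) x = word_map (six_map l) (3 # u) (h x)" for x
    unfolding fu \<theta> h_def by (simp add: field_simps)
  then have "word_map (six_map l) (4 # v) = word_map (six_map l) (3 # u) \<circ> h"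
    by (simp add: fun_eq_iff)
  moreover have "dist (h x) x < e" if "\<bar>x\<bar> \<le> R" for x
  proof -
    have "h x - x = (\<theta> - 1) * (x + 64 / 3)"
      by (simp add: h_def field_simps)
    then have "dist (h x) x = \<bar>\<theta> - 1\<bar> * \<bar>x + 64 / 3\<bar>"
      by (simp add: dist_real_def abs_mult)
    also have "\<dots> \<le> \<bar>\<theta> - 1\<bar> * (R + 22)"
      using that by (intro mult_left_mono) auto
    also have "\<dots> < e / (R + 22) * (R + 22)"
      using mn \<open>0 < R\<close> by (intro mult_strict_right_mono) (auto simp: \<theta>_def)
    finally show ?thesis using \<open>0 < R\<close> by simp
  qed
  moreover have "word_ratio (six_ratio l) (3 # u) \<le> 2 * word_ratio (six_ratio l) (4 # v)"
  proof -
    have ru: "word_ratio (six_ratio l) (3 # u) = l * (1 / 64) ^ n / 64"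
      by (simp add: u_def word_ratio_append word_ratio_replicate six_ratio_def)
    have rv: "word_ratio (six_ratio l) (4 # v) = (1 / 81) ^ m / 100 / 64"
      by (simp add: v_def word_ratio_append word_ratio_replicate six_ratio_def)
    have "1 \<le> 2 * \<theta>" using mn unfolding \<theta>_def[symmetric] by linarith
    then have "1 * (l * (1 / 64) ^ n) \<le> 2 * \<theta> * (l * (1 / 64) ^ n)"
      using l0 by (intro mult_right_mono) auto
    then show ?thesis unfolding ru rv \<theta> by simp
  qed
  moreover have "set u \<subseteq> {1..6}" "set v \<subseteq> {1..6}"
    by (auto simp: u_def v_def)
  ultimately show "\<exists>u v h. set u \<subseteq> {1..6} \<and> set v \<subseteq> {1..6} \<and>
      word_map (six_map l) (4 # v) = word_map (six_map l) (3 # u) \<circ> h \<and>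
      (\<forall>x. \<bar>x\<bar> \<le> R \<longrightarrow> dist (h x) x < e) \<and>
      word_ratio (six_ratio l) (3 # u) \<le> 2 * word_ratio (six_ratio l) (4 # v)"
    by blast
qed

lemma sum_six_ratio: "(\<Sum>i\<in>{1..6}. six_ratio l i) < 1"
proof -
  have "(\<Sum>i\<in>{1..6}. six_ratio l i) \<le> (\<Sum>i\<in>{1..6::nat}. 1 / 64)"
    using l_le by (intro sum_mono) (auto simp: six_ratio_def)
  then show ?thesis by simp
qed

end

section \<open>The attractor for a good parameter\<close>

locale good_six_maps = six_maps +
  assumes pieces_3_4: "six_map l 3 ` attractor \<inter> six_map l 4 ` attractor = {1 / 2}"
begin

lemma pieces_meet:
  assumes "i \<in> {1..6}" "j \<in> {1..6}" "i \<noteq> j" "z \<in> six_map l i ` attractor \<inter> six_map l j ` attractor"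
  shows "{i, j} = {3, 4} \<and> z = 1 / 2"
proof -
  obtain x y where xy: "x \<in> attractor" "z = six_map l i x" "y \<in> attractor" "z = six_map l j y"
    using assms(4) by auto
  have ij: "{i, j} = {3, 4}"
    using six_map_disjoint[OF attractor_unit[OF xy(1)] attractor_unit[OF xy(3)] assms(1,2)] xy assms(3)
    by simp
  then have "z \<in> six_map l 3 ` attractor \<inter> six_map l 4 ` attractor"
    using assms(4) by (auto simp: doubleton_eq_iff)
  then show ?thesis unfolding pieces_3_4 using ij by simp
qed

text \<open>A common point of the pieces of two words ending in 2 would force the rest of one of the
  words to address 0 or 1, and no such address contains the letter 2.\<close>

lemma words_ending_in_2_disjoint:
  assumes "set x \<subseteq> {1..6}" "set y \<subseteq> {1..6}" "length x = length y" "x \<noteq> y"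
  shows "word_map (six_map l) (x @ [2]) ` attractor \<inter> word_map (six_map l) (y @ [2]) ` attractor = {}"
  using assms(3,1,2,4)
proof (induction x y rule: list_induct2)
  case (Cons i x j y)
  show ?case
  proof (rule ccontr)
    assume "\<not> ?case"
    then obtain p q where p: "p \<in> attractor" "q \<in> attractor"
      and eq: "six_map l i (word_map (six_map l) (x @ [2]) p) = six_map l j (word_map (six_map l) (y @ [2]) q)"
      by auto
    have x: "set (x @ [2]) \<subseteq> {1..6}" and y: "set (y @ [2]) \<subseteq> {1..6}" and ij: "i \<in> {1..6}" "j \<in> {1..6}"
      using Cons.prems by auto
    define p' q' where "p' = word_map (six_map l) (x @ [2]) p" and "q' = word_map (six_map l) (y @ [2]) q"
    have p': "p' \<in> attractor" and q': "q' \<in> attractor"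
      using word_attractor[OF x] word_attractor[OF y] p by (auto simp: p'_def q'_def)
    have eq': "six_map l i p' = six_map l j q'" using eq by (simp add: p'_def q'_def)
    show False
    proof (cases "i = j")
      case True
      then have "p' = q'"
        using inj_S[OF ij(1)] eq' by (simp add: inj_eq)
      moreover have "x \<noteq> y" using Cons.prems True by auto
      then have "word_map (six_map l) (x @ [2]) ` attractor \<inter> word_map (six_map l) (y @ [2]) ` attractor = {}"
        using Cons.IH Cons.prems by auto
      ultimately show False
        using p unfolding p'_def q'_def by blast
    next
      case False
      have "six_map l i p' \<in> six_map l i ` attractor \<inter> six_map l j ` attractor"
        using p' q' eq' by (metis IntI imageI)
      then have "six_map l i p' = 1 / 2"
        using pieces_meet[OF ij False] by blast
      then have "p' = 0 \<or> p' = 1"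
        using six_map_eq_half[OF attractor_unit[OF p'] ij(1)] by blast
      then show False
        using word_eq_0[OF x attractor_unit[OF p(1)]] word_eq_1[OF x attractor_unit[OF p(1)]]
        unfolding p'_def by auto
    qed
  qed
qed simp

text \<open>The only critical point is 1/2. A non-empty word maps a point of the unit interval to
  1/2 only if the point is 0 or 1, and these have only the constant addresses 1 and 6.\<close>

lemma post_critically_finite_attractor: "post_critically_finite {1..6} (six_map l) attractor"
proof -
  have "\<alpha> \<in> {\<lambda>_. 1, \<lambda>_. 6}"
    if \<alpha>: "range \<alpha> \<subseteq> {1..6}" and w: "w \<noteq> []" "set w \<subseteq> {1..6}"
      "word_map (six_map l) w (addr (six_map l) attractor \<alpha>) \<in> critical_set {1..6} (six_map l) attractor"
    for \<alpha> w
  proof -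
    define p where "p = addr (six_map l) attractor \<alpha>"
    have mem: "p \<in> word_map (six_map l) (map \<alpha> [0..<n]) ` attractor" for n
      unfolding p_def by (rule addr_mem[OF \<alpha>])
    then have p: "p \<in> {0..1}" using mem[of 0] attractor_unit by auto
    obtain i j where ij: "i \<in> {1..6}" "j \<in> {1..6}" "word_map (six_map l) w p \<in>
      (if i \<noteq> j then six_map l i ` attractor \<inter> six_map l j ` attractor else {})"
      using w(3) unfolding critical_set_def p_def[symmetric] by blast
    then have "word_map (six_map l) w p = 1 / 2"
      using pieces_meet[OF ij(1,2)] by (cases "i = j") simp_all
    moreover obtain i w' where iw: "w = i # w'" using w(1) by (cases w) auto
    ultimately have half: "six_map l i (word_map (six_map l) w' p) = 1 / 2" by simp
    have w': "set w' \<subseteq> {1..6}" "i \<in> {1..6}" using w(2) iw by auto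
    have "word_map (six_map l) w' p = 0 \<or> word_map (six_map l) w' p = 1"
      using six_map_eq_half[OF word_unit[OF w'(1) p] w'(2) half] by blast
    then have "p = 0 \<or> p = 1"
      using word_eq_0[OF w'(1) p] word_eq_1[OF w'(1) p] by blast
    have sub: "set (map \<alpha> [0..<Suc n]) \<subseteq> {1..6}" for n
      using \<alpha> unfolding set_map by blast
    \<comment> \<open>The prefix of length \<open>Suc n\<close> is the shortest that reaches the
      letter with index \<open>n\<close>.\<close>
    have n: "\<alpha> n \<in> set (map \<alpha> [0..<Suc n])" for n
      by simp
    have "\<alpha> n = 1" if "p = 0" for n
    proof -
      obtain z where z: "p = word_map (six_map l) (map \<alpha> [0..<Suc n]) z" "z \<in> attractor"
        using mem[of "Suc n"] by (rule imageE)
      show ?thesis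
        using word_eq_0[OF sub attractor_unit[OF z(2)] z(1)[unfolded that, symmetric]] n by blast
    qed
    moreover have "\<alpha> n = 6" if "p = 1" for n
    proof -
      obtain z where z: "p = word_map (six_map l) (map \<alpha> [0..<Suc n]) z" "z \<in> attractor"
        using mem[of "Suc n"] by (rule imageE)
      show ?thesis
        using word_eq_1[OF sub attractor_unit[OF z(2)] z(1)[unfolded that, symmetric]] n by blast
    qed
    ultimately show ?thesis using \<open>p = 0 \<or> p = 1\<close> by auto
  qed
  then have "{\<alpha>. range \<alpha> \<subseteq> {1..6} \<and> (\<exists>w. w \<noteq> [] \<and> set w \<subseteq> {1..6} \<and>
      word_map (six_map l) w (addr (six_map l) attractor \<alpha>) \<in> critical_set {1..6} (six_map l) attractor)}
      \<subseteq> {\<lambda>_. 1, \<lambda>_. 6}"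
    by blast
  then show ?thesis
    unfolding post_critically_finite_def by (rule finite_subset) simp
qed

lemma hausdorff_measure_attractor:
  "hausdorff_measure (sim_dim {1..6} (six_ratio l)) attractor = 0"
  using nearly_coincident_content_eq_0[OF _ _ _ nearly_coincident_3_4 sim_dim_properties(2)[OF sum_six_ratio]]
    sim_dim_properties(1)[OF sum_six_ratio]
  by (intro hausdorff_measure_eq_0_if_content bounded_attractor) auto

text \<open>The similarity dimension itself belongs to the set of exponents because the measure
  vanishes there, so it remains to exclude smaller ones.\<close>

lemma hausdorff_dim_attractor: "hausdorff_dim attractor = sim_dim {1..6} (six_ratio l)"
proof -
  define s where "s = sim_dim {1..6} (six_ratio l)"
  have "s \<le> t" if t: "0 \<le> t" "hausdorff_measure t attractor = 0" for t
  proof (rule ccontr)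
    assume "\<not> s \<le> t"
    \<comment> \<open>An exponent strictly above \<open>t\<close> is positive even for
      \<open>t = 0\<close>, as both content lemmas require, and below \<open>s\<close> the power sum
      still exceeds 1.\<close>
    then obtain t' where t': "t < t'" "t' < s" using dense[of t s] by auto
    have "ball_content t' attractor = 0"
      by (rule content_eq_0_if_hausdorff_measure[OF _ t(1) _ compact_attractor t(2)]) (use t t' in auto)
    moreover have "0 < ball_content t' attractor"
    proof (rule content_pos_if_disjoint_words)
      show "1 < (\<Sum>i\<in>{1..6}. six_ratio l i powr t')"
        using sim_dim_properties(3)[OF sum_six_ratio] t'(2) by (simp add: s_def)
      show "(2 :: nat) \<in> {1..6}" by simp
    qed (use t t' words_ending_in_2_disjoint in auto)
    ultimately show False by simp
  qed
  then show ?thesis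
    unfolding hausdorff_dim_def s_def[symmetric]
    using hausdorff_measure_attractor sim_dim_properties(1)[OF sum_six_ratio]
    by (intro cInf_eq_minimum) (auto simp: s_def)
qed

end

theorem theorem1:
  shows "\<exists>(S :: nat \<Rightarrow> real \<Rightarrow> real) (r :: nat \<Rightarrow> real) K.
     (\<forall>i\<in>{1..6}. contr_sim (S i) (r i)) \<and>
     is_attractor {1..6} S K \<and>
     totally_disconnected K \<and> K \<subseteq> {0..1} \<and> {0, 1} \<subseteq> K \<and>
     \<not> open_set_condition {1..6} S \<and>
     (\<forall>i\<in>{1..6}. \<forall>j\<in>{1..6}. i \<noteq> j \<longrightarrow> S i ` K \<inter> S j ` K \<noteq> {} \<longrightarrow>
        {i, j} = {3, 4}) \<and>
     S 3 ` K \<inter> S 4 ` K = {S 3 0} \<and> S 3 0 = S 4 1 \<and>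
     post_critically_finite {1..6} S K \<and>
     hausdorff_dim K = sim_dim {1..6} r \<and>
     hausdorff_measure (sim_dim {1..6} r) K = 0"
proof -
  obtain l where l: "six_maps l"
    "six_map l 3 ` unit_ifs.attractor {1..6} (six_map l) \<inter> six_map l 4 ` unit_ifs.attractor {1..6} (six_map l) = {1 / 2}"
    by (rule exists_good_param)
  interpret good_six_maps l
    by (intro good_six_maps.intro good_six_maps_axioms.intro l)
  show ?thesis
  proof (intro exI[of _ "six_map l"] exI[of _ "six_ratio l"] exI[of _ attractor] conjI ballI impI)
    show "\<not> open_set_condition {1..6} (six_map l)"
      by (rule nearly_coincident_not_osc[OF _ _ _ nearly_coincident_3_4]) auto
    show "six_map l 3 ` attractor \<inter> six_map l 4 ` attractor = {six_map l 3 0}" "six_map l 3 0 = six_map l 4 1"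
      using pieces_3_4 by (auto simp: six_map_def)
    show "{i, j} = {3, 4}" if "i \<in> {1..6}" "j \<in> {1..6}" "i \<noteq> j"
      "six_map l i ` attractor \<inter> six_map l j ` attractor \<noteq> {}" for i j
      using pieces_meet[OF that(1-3)] that(4) by blast
  qed (use contr is_attractor_attractor totally_disconnected_attractor[OF sum_six_ratio] attractor_subset
      zero_in_attractor one_in_attractor post_critically_finite_attractor hausdorff_dim_attractor
      hausdorff_measure_attractor in auto)
qed

end
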